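(* Let $K$ be an algebraically closed field of characteristic zero, $V=K^N$, $\mathfrak{g}=\mathfrak{sl}(V)$. Let $k\ge 1$, let $1\le n_1<\cdots<n_k\le N-1$ and $l_1,\ldots,l_k\ge 1$ be integers, and let $L(\lambda)$ be the irreducible finite dimensional $\mathfrak{g}$-module with highest weight $\lambda=\sum_{i=1}^k l_i\omega_{n_i}$ and highest weight vector $v$. Let $m(\lambda)=\min\{l_1,\ldots,l_k\}$. Let $V_\bullet$ be the flag attached to $n_1<\cdots<n_k$, let $\mathfrak{n}(V_\bullet)_{op}$ be its opposite radical, and let $z_1,\ldots,z_d$ be a basis of $\mathfrak{n}(V_\bullet)_{op}$. For every integer $l$ with $1\le l\le m(\lambda)$ the following hold, where $L_l(\lambda)=\mathrm{U}_l(\mathfrak{g})v$: (1) The set $B_l(\lambda)=\{z_1^{a_1}\cdots z_d^{a_d}(v) : a_i\ge 0,\ 0\le \sum_i a_i\le l\}$ is a basis of the $K$-vector space $L_l(\lambda)$. (2) With $b_i=n_i-n_{i-1}$ for $1\le i\le k+1$ (where $n_0=0$, $n_{k+1}=N$) and $D=\sum_{1\le j<i\le k+1}b_ib_j$, $$\dim_K L_l(\lambda)=\binom{D+l}{D}.$$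
   Context: $\mathfrak{h}\subseteq\mathfrak{g}$ is the subalgebra of trace-zero diagonal matrices; $L_i\in\mathfrak{h}^*$ is the function returning the $i$-th diagonal entry, and $\omega_i=L_1+\cdots+L_i$ ($1\le i\le N-1$) are the fundamental weights. The positive roots are $L_i-L_j$ with $i<j$, so a highest weight vector is annihilated by all strictly upper triangular matrices. With $e_1,\ldots,e_N$ the standard basis of $V$ and $V_i=\operatorname{span}(e_1,\ldots,e_{n_i})$, the flag is $V_\bullet: 0\ne V_1\subsetneq\cdots\subsetneq V_k\subsetneq V_{k+1}=V$. The stabilizer $\mathfrak{p}(V_\bullet)$ of the flag is the Lie algebra of trace-zero block upper triangular matrices with diagonal blocks of sizes $b_1,\ldots,b_{k+1}$. The opposite parabolic $\mathfrak{p}(V_\bullet)_{op}$ consists of the trace-zero block lower triangular matrices with the same block sizes, and the opposite radical $\mathfrak{n}(V_\bullet)_{op}$ is the nilpotent radical of $\mathfrak{p}(V_\bullet)_{op}$, i.e. the Lie algebra of strictly block lower triangular matrices (zero diagonal blocks). $\mathrm{U}(\mathfrak{g})$ is the universal enveloping algebra and $\mathrm{U}_l(\mathfrak{g})$ its canonical filtration: the span of products of at most $l$ elements of $\mathfrak{g}$. The canonical filtration of $L(\lambda)$ is $L_l(\lambda)=\{x(v):x\in\mathrm{U}_l(\mathfrak{g})\}$. *)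

theory Defs
  imports
    "Jordan_Normal_Form.VS_Connect"
    "HOL-Algebra.QuotRing"
    "HOL-Library.Poly_Mapping"
    "HOL-Computational_Algebra.Polynomial"
begin

section \<open>The universal enveloping algebra of a Lie algebra of matrices\<close>

text \<open>
  Words over an alphabet, as an additively written free monoid: finitely supported functions
  from words to \<open>'k\<close> then carry the convolution product of \<open>Poly_Mapping\<close>, which makes them the
  free associative algebra.
\<close>

datatype 'a word = Word (letters: "'a list")

instantiation word :: (type) monoid_add
begin
definition zero_word :: "'a word" where "0 = Word []"
definition plus_word :: "'a word \<Rightarrow> 'a word \<Rightarrow> 'a word"
  where "u + w = Word (letters u @ letters w)"
instance by standard (simp_all add: zero_word_def plus_word_def)
end

definition free_alg :: "'k::field mat set \<Rightarrow> ('k mat word \<Rightarrow>\<^sub>0 'k) ring" where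
  "free_alg g = \<lparr>carrier = {p. \<forall>w \<in> Poly_Mapping.keys p. set (letters w) \<subseteq> g},
     mult = (*), one = 1, zero = 0, add = (+)\<rparr>"

definition free_gen :: "'k::field mat \<Rightarrow> 'k mat word \<Rightarrow>\<^sub>0 'k" where
  "free_gen x = Poly_Mapping.single (Word [x]) 1"

definition free_const :: "'k::field \<Rightarrow> 'k mat word \<Rightarrow>\<^sub>0 'k" where
  "free_const c = Poly_Mapping.single 0 c"

definition lie_bracket :: "'k::field mat \<Rightarrow> 'k mat \<Rightarrow> 'k mat" where
  "lie_bracket x y = x * y - y * x"

text \<open>
  The first two families turn the free algebra on the set \<open>g\<close> into the tensor algebra of the
  vector space \<open>g\<close>.
\<close>

definition uea_relations :: "'k::field mat set \<Rightarrow> ('k mat word \<Rightarrow>\<^sub>0 'k) set" where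
  "uea_relations g =
     {free_gen (x + y) - free_gen x - free_gen y | x y. x \<in> g \<and> y \<in> g}
   \<union> {free_gen (c \<cdot>\<^sub>m x) - free_const c * free_gen x | c x. x \<in> g}
   \<union> {free_gen x * free_gen y - free_gen y * free_gen x - free_gen (lie_bracket x y) | x y.
        x \<in> g \<and> y \<in> g}"

definition uea_ideal :: "'k::field mat set \<Rightarrow> ('k mat word \<Rightarrow>\<^sub>0 'k) set" where
  "uea_ideal g = genideal (free_alg g) (uea_relations g)"

definition uea :: "'k::field mat set \<Rightarrow> ('k mat word \<Rightarrow>\<^sub>0 'k) set ring" where
  "uea g = free_alg g Quot uea_ideal g"

text \<open>
  A linear combination of products of at most \<open>l\<close> elements of \<open>g\<close> is the class of an element
  of the free algebra that involves only words of length at most \<open>l\<close>.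
\<close>

definition uea_filtration :: "'k::field mat set \<Rightarrow> nat \<Rightarrow> ('k mat word \<Rightarrow>\<^sub>0 'k) set set" where
  "uea_filtration g l =
     {X \<in> carrier (uea g). \<exists>p \<in> carrier (free_alg g).
        X = uea_ideal g +>\<^bsub>free_alg g\<^esub> p \<and>
        (\<forall>w \<in> Poly_Mapping.keys p. length (letters w) \<le> l)}"


section \<open>Modules over a Lie algebra of matrices\<close>

text \<open>
  The module is the whole type \<open>'v\<close>, with scalar multiplication \<open>scale\<close>. The action
  \<open>\<rho> x\<close> is constrained for \<open>x \<in> g\<close> only.
\<close>

definition lie_module ::
  "'k::field mat set \<Rightarrow> ('k \<Rightarrow> 'v::ab_group_add \<Rightarrow> 'v) \<Rightarrow> ('k mat \<Rightarrow> 'v \<Rightarrow> 'v) \<Rightarrow> bool" where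
  "lie_module g scale \<rho> \<longleftrightarrow>
     vector_space scale \<and>
     (\<forall>x\<in>g. Vector_Spaces.linear scale scale (\<rho> x)) \<and>
     (\<forall>x\<in>g. \<forall>y\<in>g. \<forall>u. \<rho> (x + y) u = \<rho> x u + \<rho> y u) \<and>
     (\<forall>c. \<forall>x\<in>g. \<forall>u. \<rho> (c \<cdot>\<^sub>m x) u = scale c (\<rho> x u)) \<and>
     (\<forall>x\<in>g. \<forall>y\<in>g. \<forall>u. \<rho> (lie_bracket x y) u = \<rho> x (\<rho> y u) - \<rho> y (\<rho> x u))"

definition finite_dim :: "('k::field \<Rightarrow> 'v::ab_group_add \<Rightarrow> 'v) \<Rightarrow> bool" where
  "finite_dim scale \<longleftrightarrow> (\<exists>B. finite B \<and> Modules.module.span scale B = UNIV)"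

definition irreducible_module ::
  "'k::field mat set \<Rightarrow> ('k \<Rightarrow> 'v::ab_group_add \<Rightarrow> 'v) \<Rightarrow> ('k mat \<Rightarrow> 'v \<Rightarrow> 'v) \<Rightarrow> bool" where
  "irreducible_module g scale \<rho> \<longleftrightarrow>
     lie_module g scale \<rho> \<and>
     (UNIV :: 'v set) \<noteq> {0} \<and>
     (\<forall>S. Modules.module.subspace scale S \<and> (\<forall>x\<in>g. \<forall>u\<in>S. \<rho> x u \<in> S)
        \<longrightarrow> S = {0} \<or> S = UNIV)"

definition free_act ::
  "('k::field \<Rightarrow> 'v::ab_group_add \<Rightarrow> 'v) \<Rightarrow> ('k mat \<Rightarrow> 'v \<Rightarrow> 'v) \<Rightarrow> ('k mat word \<Rightarrow>\<^sub>0 'k) \<Rightarrow> 'v \<Rightarrow> 'v"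
  where "free_act scale \<rho> p u =
    (\<Sum>w\<in>Poly_Mapping.keys p. scale (Poly_Mapping.lookup p w) (foldr \<rho> (letters w) u))"

text \<open>
  For a \<open>lie_module\<close> the ideal \<open>uea_ideal g\<close> acts by zero, so that the choice of the
  representative is immaterial.
\<close>

definition uea_act ::
  "('k::field \<Rightarrow> 'v::ab_group_add \<Rightarrow> 'v) \<Rightarrow> ('k mat \<Rightarrow> 'v \<Rightarrow> 'v) \<Rightarrow> ('k mat word \<Rightarrow>\<^sub>0 'k) set \<Rightarrow> 'v \<Rightarrow> 'v"
  where "uea_act scale \<rho> X u = free_act scale \<rho> (SOME p. p \<in> X) u"

definition canonical_filtration ::
  "'k::field mat set \<Rightarrow> ('k \<Rightarrow> 'v::ab_group_add \<Rightarrow> 'v) \<Rightarrow> ('k mat \<Rightarrow> 'v \<Rightarrow> 'v) \<Rightarrow> 'v \<Rightarrow> nat \<Rightarrow> 'v set"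
  where "canonical_filtration g scale \<rho> v l = {uea_act scale \<rho> x v | x. x \<in> uea_filtration g l}"


section \<open>Weights of \<open>sl N\<close>\<close>

text \<open>
  Matrix indices run from \<open>0\<close> to \<open>N - 1\<close>, while \<open>diag_entry i\<close> (written $L_i$) and
  \<open>fund_weight i\<close> (written $\omega_i$) keep the numbering from \<open>1\<close>.
\<close>

definition sl :: "nat \<Rightarrow> 'k::field mat set" where
  "sl N = {x \<in> carrier_mat N N. (\<Sum>i<N. x $$ (i, i)) = 0}"

definition cartan :: "nat \<Rightarrow> 'k::field mat set" where
  "cartan N = {h \<in> sl N. diagonal_mat h}"

definition diag_entry :: "nat \<Rightarrow> 'k::field mat \<Rightarrow> 'k" where
  "diag_entry i h = h $$ (i - 1, i - 1)"

definition fund_weight :: "nat \<Rightarrow> 'k::field mat \<Rightarrow> 'k" where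
  "fund_weight i h = (\<Sum>j=1..i. diag_entry j h)"

definition strictly_upper :: "nat \<Rightarrow> 'k::field mat set" where
  "strictly_upper N = {x \<in> carrier_mat N N. \<forall>i<N. \<forall>j\<le>i. x $$ (i, j) = 0}"

definition highest_weight_vector ::
  "nat \<Rightarrow> ('k::field \<Rightarrow> 'v::ab_group_add \<Rightarrow> 'v) \<Rightarrow> ('k mat \<Rightarrow> 'v \<Rightarrow> 'v) \<Rightarrow> ('k mat \<Rightarrow> 'k) \<Rightarrow> 'v \<Rightarrow> bool"
  where "highest_weight_vector N scale \<rho> lam v \<longleftrightarrow>
    v \<noteq> 0 \<and> (\<forall>h\<in>cartan N. \<rho> h v = scale (lam h) v) \<and> (\<forall>x\<in>strictly_upper N. \<rho> x v = 0)"


section \<open>The opposite radical of a flag\<close>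

text \<open>
  A flag is given by \<open>0 = n 0 < n 1 < \<dots> < n (k + 1) = N\<close>; block \<open>s\<close>, for
  \<open>1 \<le> s \<le> k + 1\<close>, consists of the 0-based indices \<open>n (s - 1), \<dots>, n s - 1\<close>.
\<close>

definition opposite_radical :: "nat \<Rightarrow> nat \<Rightarrow> (nat \<Rightarrow> nat) \<Rightarrow> 'k::field mat set" where
  "opposite_radical N k n =
     {x \<in> carrier_mat N N. \<forall>s\<in>{1..k+1}. \<forall>t\<in>{1..k+1}. s \<le> t \<longrightarrow>
        (\<forall>i\<in>{n (s - 1)..<n s}. \<forall>j\<in>{n (t - 1)..<n t}. x $$ (i, j) = 0)}"

definition is_matrix_basis ::
  "nat \<Rightarrow> 'k::field mat set \<Rightarrow> nat \<Rightarrow> (nat \<Rightarrow> 'k mat) \<Rightarrow> bool" where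
  "is_matrix_basis N S d z \<longleftrightarrow>
     inj_on z {1..d} \<and>
     vectorspace.basis (class_ring :: 'k ring)
       ((module_mat TYPE('k) N N)\<lparr>carrier := S\<rparr>) (z ` {1..d})"

text \<open>\<open>monomial_act \<rho> d z a v\<close> is $z_1^{a_1} \cdots z_d^{a_d}(v)$; \<open>z d\<close> acts first.\<close>

definition monomial_act ::
  "('k mat \<Rightarrow> 'v \<Rightarrow> 'v) \<Rightarrow> nat \<Rightarrow> (nat \<Rightarrow> 'k mat) \<Rightarrow> (nat \<Rightarrow> nat) \<Rightarrow> 'v \<Rightarrow> 'v" where
  "monomial_act \<rho> d z a v = foldr (\<lambda>i u. (\<rho> (z i) ^^ a i) u) [1..<d+1] v"

end

theory Submission
  imports Defs "HOL-Library.Product_Plus" "HOL-Library.Function_Algebras" "HOL-Library.Countable"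
begin

text \<open>
  Write \<open>v\<close> for the highest weight vector and \<open>F l\<close> for \<open>L_l(\<lambda>)\<close>. The theorem is an upper bound for
  \<open>F l\<close> (the ordered monomials of degree at most \<open>l\<close> span it) and a matching lower bound (they are
  linearly independent).

  \<^bold>\<open>Spanning.\<close> The letters of a word applied to \<open>v\<close> commute modulo shorter words, so a letter that
  stabilises the line of \<open>v\<close> can be moved to the right and absorbed. The block upper triangular
  matrices do stabilise this line: this is the definition of a highest weight vector for upper
  triangular matrices, and for a matrix unit \<open>E\<^sub>i\<^sub>j\<close> below the diagonal but inside a diagonal block, \<open>v\<close>
  generates a finite-dimensional representation of the copy of \<open>sl 2\<close> spanned by \<open>E\<^sub>i\<^sub>j\<close>, \<open>E\<^sub>j\<^sub>i\<close> and their
  bracket in which it is a highest weight vector of weight \<open>0\<close>, hence \<open>E\<^sub>i\<^sub>j v = 0\<close>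
  (\<open>lowering_kills_equal_weights\<close>). Only letters from the opposite radical remain, and they can be
  expanded in the given basis and sorted (\<open>filtration_eq_span_ordered_monomials\<close>).

  \<^bold>\<open>Independence.\<close> The number of ordered monomials is the same for every basis of the opposite
  radical, and a spanning family with as many members as the dimension is a basis. So it is enough
  to treat one basis, and the matrix units \<open>E\<^sub>i\<^sub>j\<close> are taken. They are studied in an explicit model
  of weight \<open>\<lambda>\<close>: in the exterior algebra of a sum of copies of \<open>V\<close>, called legs, with \<open>l_s\<close> legs of type \<open>s\<close> for
  \<open>1 \<le> s \<le> k\<close>, the vector \<open>v'\<close> is the product, over all legs, of \<open>e_1 \<and> \<dots> \<and> e_(n_s)\<close>. Each \<open>E\<^sub>i\<^sub>j\<close>
  acts on one leg at a time. If a monomial has degree \<open>q \<le> min(l_1, \<dots>, l_k)\<close>, its factors can act on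
  \<open>q\<close> distinct legs, each of a type that separates \<open>j\<close> from \<open>i\<close>; the basis vector obtained
  in this way occurs in that monomial and in no other monomial of degree at most \<open>q\<close>. Looking at the
  terms of top degree, one sees that the monomials are independent (\<open>fock_words_independent\<close>).

  \<^bold>\<open>Transfer.\<close> The standard bilinear form of the model makes \<open>E\<^sub>i\<^sub>j\<close> and \<open>E\<^sub>j\<^sub>i\<close> adjoint, so the inner
  product of \<open>x v'\<close> and \<open>y v'\<close> is the coefficient of \<open>v'\<close> in \<open>x\<^sup>T y v'\<close>. That coefficient depends only on the
  weight (\<open>common_vacuum_coefficient\<close>) and can therefore be computed in \<open>L(\<lambda>)\<close> as well. The Gram
  matrix of the monomials consists of integers and is positive definite over the rationals, so it is nonsingular
  over every field of characteristic zero, and a linear relation among the monomials in \<open>L(\<lambda>)\<close>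
  has to be trivial (\<open>lowering_words_independent\<close>).
\<close>

section \<open>Words in a Lie algebra and its enveloping algebra\<close>

locale matrix_lie_module = vector_space scale
  for scale :: "'k::field \<Rightarrow> 'v::ab_group_add \<Rightarrow> 'v" +
  fixes g :: "'k mat set" and \<rho> :: "'k mat \<Rightarrow> 'v \<Rightarrow> 'v"
  assumes lie_module: "lie_module g scale \<rho>"
    and add_closed: "x \<in> g \<Longrightarrow> y \<in> g \<Longrightarrow> x + y \<in> g"
    and smult_closed: "x \<in> g \<Longrightarrow> c \<cdot>\<^sub>m x \<in> g"
    and bracket_closed: "x \<in> g \<Longrightarrow> y \<in> g \<Longrightarrow> lie_bracket x y \<in> g"
begin

lemma act_linear: "x \<in> g \<Longrightarrow> Vector_Spaces.linear scale scale (\<rho> x)"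
  using lie_module by (auto simp: lie_module_def)

lemma act_add: "x \<in> g \<Longrightarrow> \<rho> x (u + w) = \<rho> x u + \<rho> x w"
  and act_scale: "x \<in> g \<Longrightarrow> \<rho> x (scale c u) = scale c (\<rho> x u)"
  and act_zero: "x \<in> g \<Longrightarrow> \<rho> x 0 = 0"
  and act_diff: "x \<in> g \<Longrightarrow> \<rho> x (u - w) = \<rho> x u - \<rho> x w"
  and act_sum: "x \<in> g \<Longrightarrow> \<rho> x (sum f I) = (\<Sum>i\<in>I. \<rho> x (f i))"
proof -
  assume "x \<in> g"
  then interpret L: Vector_Spaces.linear scale scale "\<rho> x" by (rule act_linear)
  show "\<rho> x (u + w) = \<rho> x u + \<rho> x w" by (rule L.add)
  show "\<rho> x (scale c u) = scale c (\<rho> x u)" by (rule L.scale)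
  show "\<rho> x 0 = 0" by (rule L.zero)
  show "\<rho> x (u - w) = \<rho> x u - \<rho> x w" by (rule L.diff)
  show "\<rho> x (sum f I) = (\<Sum>i\<in>I. \<rho> x (f i))" by (rule L.sum)
qed

lemma act_add_left: "x \<in> g \<Longrightarrow> y \<in> g \<Longrightarrow> \<rho> (x + y) u = \<rho> x u + \<rho> y u"
  and act_smult: "x \<in> g \<Longrightarrow> \<rho> (c \<cdot>\<^sub>m x) u = scale c (\<rho> x u)"
  and act_bracket: "x \<in> g \<Longrightarrow> y \<in> g \<Longrightarrow> \<rho> (lie_bracket x y) u = \<rho> x (\<rho> y u) - \<rho> y (\<rho> x u)"
  using lie_module by (auto simp: lie_module_def)

abbreviation act_word :: "'k mat list \<Rightarrow> 'v \<Rightarrow> 'v" where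
  "act_word xs u \<equiv> foldr \<rho> xs u"

lemma act_word_add: "set xs \<subseteq> g \<Longrightarrow> act_word xs (u + w) = act_word xs u + act_word xs w"
  and act_word_scale: "set xs \<subseteq> g \<Longrightarrow> act_word xs (scale c u) = scale c (act_word xs u)"
  by (induction xs) (auto simp: act_add act_scale)

lemma act_word_sum: "set xs \<subseteq> g \<Longrightarrow> act_word xs (sum f I) = (\<Sum>i\<in>I. act_word xs (f i))"
  by (induction xs) (auto simp: act_sum)

text \<open>
  The span of all words of length at most \<open>l\<close> applied to \<open>v\<close>: the form of the canonical filtration in
  which no quotient of a free algebra appears. The two agree by \<open>canonical_filtration_eq\<close>.
\<close>

definition filtration :: "'v \<Rightarrow> nat \<Rightarrow> 'v set" where
  "filtration v l = span {act_word xs v | xs. set xs \<subseteq> g \<and> length xs \<le> l}"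

lemma free_act_superset:
  assumes "finite A" "Poly_Mapping.keys p \<subseteq> A"
  shows "free_act scale \<rho> p u =
    (\<Sum>w\<in>A. scale (Poly_Mapping.lookup p w) (act_word (letters w) u))"
  unfolding free_act_def using assms
  by (intro sum.mono_neutral_left) (auto simp: in_keys_iff)

lemma free_act_add: "free_act scale \<rho> (p + q) u = free_act scale \<rho> p u + free_act scale \<rho> q u"
  using Poly_Mapping.keys_add[of p q]
    free_act_superset[of "Poly_Mapping.keys p \<union> Poly_Mapping.keys q" p u]
    free_act_superset[of "Poly_Mapping.keys p \<union> Poly_Mapping.keys q" q u]
    free_act_superset[of "Poly_Mapping.keys p \<union> Poly_Mapping.keys q" "p + q" u]
  by (simp add: lookup_add scale_left_distrib sum.distrib)

lemma free_act_zero [simp]: "free_act scale \<rho> 0 u = 0"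
  by (simp add: free_act_def)

lemma free_act_single [simp]:
  "free_act scale \<rho> (Poly_Mapping.single w c) u = scale c (act_word (letters w) u)"
  by (simp add: free_act_def)

lemma free_act_uminus: "free_act scale \<rho> (- p) u = - free_act scale \<rho> p u"
  by (metis add.commute add.right_inverse free_act_add free_act_zero minus_unique)

lemma free_act_diff: "free_act scale \<rho> (p - q) u = free_act scale \<rho> p u - free_act scale \<rho> q u"
  using free_act_add[of p "- q"] by (simp add: free_act_uminus)

lemma free_act_sum: "free_act scale \<rho> (sum f I) u = (\<Sum>i\<in>I. free_act scale \<rho> (f i) u)"
  by (induction I rule: infinite_finite_induct) (auto simp: free_act_add)

lemma poly_mapping_as_sum:
  "p = (\<Sum>w\<in>Poly_Mapping.keys p. Poly_Mapping.single w (Poly_Mapping.lookup p w))"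
  for p :: "'x \<Rightarrow>\<^sub>0 'y::comm_monoid_add"
  by (rule poly_mapping_eqI)
     (auto simp: lookup_sum lookup_single when_def in_keys_iff)

text \<open>
  The left factor has to be supported on words over \<open>g\<close>: its letters must act linearly for the sum
  coming from the right factor to be pulled out.
\<close>

lemma free_act_mult:
  assumes "p \<in> carrier (free_alg g)"
  shows "free_act scale \<rho> (p * q) u = free_act scale \<rho> p (free_act scale \<rho> q u)"
proof -
  let ?P = "Poly_Mapping.keys p" and ?Q = "Poly_Mapping.keys q"
  let ?l = "Poly_Mapping.lookup"
  have "p * q = (\<Sum>w\<in>?P. \<Sum>w'\<in>?Q. Poly_Mapping.single (w + w') (?l p w * ?l q w'))"
    using arg_cong2[where f = "(*)", OF poly_mapping_as_sum[of p] poly_mapping_as_sum[of q]]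
    by (simp only: sum_product mult_single)
  then have "free_act scale \<rho> (p * q) u
      = (\<Sum>w\<in>?P. \<Sum>w'\<in>?Q. scale (?l p w * ?l q w') (act_word (letters w) (act_word (letters w') u)))"
    by (simp add: free_act_sum plus_word_def)
  also have "\<dots> = free_act scale \<rho> p (free_act scale \<rho> q u)"
    unfolding free_act_def using assms
    by (intro sum.cong refl)
       (simp add: free_alg_def act_word_sum act_word_scale scale_sum_right)
  finally show ?thesis .
qed

lemma free_alg_ring: "ring (free_alg h)" for h :: "'k mat set"
proof (rule ringI)
  show "abelian_group (free_alg h)"
  proof (rule abelian_groupI)
    fix p assume p: "p \<in> carrier (free_alg h)"
    then have "- p \<in> carrier (free_alg h)" by (auto simp: free_alg_def in_keys_iff)
    then show "\<exists>q\<in>carrier (free_alg h). q \<oplus>\<^bsub>free_alg h\<^esub> p = \<zero>\<^bsub>free_alg h\<^esub>"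
      by (intro bexI[of _ "- p"]) (auto simp: free_alg_def)
  next
    fix p q assume "p \<in> carrier (free_alg h)" "q \<in> carrier (free_alg h)"
    then show "p \<oplus>\<^bsub>free_alg h\<^esub> q \<in> carrier (free_alg h)"
      using Poly_Mapping.keys_add[of p q] by (auto simp: free_alg_def)
  qed (auto simp: free_alg_def add_ac)
  have "p * q \<in> carrier (free_alg h)"
    if "p \<in> carrier (free_alg h)" "q \<in> carrier (free_alg h)" for p q
  proof -
    have "set (letters w) \<subseteq> h" if w: "w \<in> Poly_Mapping.keys (p * q)" for w
    proof -
      obtain a b where "w = a + b" "a \<in> Poly_Mapping.keys p" "b \<in> Poly_Mapping.keys q"
        using Poly_Mapping.keys_mult[of p q] w by blast
      then show ?thesis
        using \<open>p \<in> _\<close> \<open>q \<in> _\<close> by (simp add: free_alg_def plus_word_def)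
    qed
    then show ?thesis by (simp add: free_alg_def)
  qed
  note mult_closed = this
  show "monoid (free_alg h)"
  proof (rule monoidI)
    show "\<one>\<^bsub>free_alg h\<^esub> \<in> carrier (free_alg h)"
      by (simp add: free_alg_def zero_word_def)
  next
    fix p q assume "p \<in> carrier (free_alg h)" "q \<in> carrier (free_alg h)"
    then have "p * q \<in> carrier (free_alg h)" by (rule mult_closed)
    then show "p \<otimes>\<^bsub>free_alg h\<^esub> q \<in> carrier (free_alg h)" by (simp add: free_alg_def)
  qed (simp_all add: free_alg_def mult.assoc)
qed (simp_all add: free_alg_def distrib_left distrib_right)

lemma uea_relations_closed: "uea_relations g \<subseteq> carrier (free_alg g)"
proof -
  interpret F: ring "free_alg g" by (rule free_alg_ring)
  have gen: "free_gen x \<in> carrier (free_alg g)" if "x \<in> g" for x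
    using that by (auto simp: free_alg_def free_gen_def)
  have const: "free_const c \<in> carrier (free_alg g)" for c
    by (auto simp: free_alg_def free_const_def zero_word_def)
  have diff: "p - q \<in> carrier (free_alg g)"
    if "p \<in> carrier (free_alg g)" "q \<in> carrier (free_alg g)" for p q
    using that keys_diff[of p q] by (auto simp: free_alg_def in_keys_iff lookup_minus)
  have mult: "p * q \<in> carrier (free_alg g)"
    if "p \<in> carrier (free_alg g)" "q \<in> carrier (free_alg g)" for p q
    using F.m_closed[OF that] by (simp add: free_alg_def)
  show ?thesis
    unfolding uea_relations_def
  proof (intro Un_least subsetI; clarify)
    fix x y assume "x \<in> g" "y \<in> g"
    then show "free_gen (x + y) - free_gen x - free_gen y \<in> carrier (free_alg g)"
      by (intro diff gen add_closed)
  next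
    fix c x assume "x \<in> g"
    then show "free_gen (c \<cdot>\<^sub>m x) - free_const c * free_gen x \<in> carrier (free_alg g)"
      by (intro diff mult gen const smult_closed)
  next
    fix x y assume "x \<in> g" "y \<in> g"
    then show "free_gen x * free_gen y - free_gen y * free_gen x - free_gen (lie_bracket x y)
        \<in> carrier (free_alg g)"
      by (intro diff mult gen bracket_closed)
  qed
qed

text \<open>
  The elements that annihilate the whole module form a two-sided ideal, and the axioms of a Lie module
  say exactly that it contains the defining relations.
\<close>

lemma uea_ideal_acts_by_zero:
  assumes "p \<in> uea_ideal g"
  shows "free_act scale \<rho> p u = 0"
proof -
  interpret F: ring "free_alg g" by (rule free_alg_ring)
  define I where "I = {p \<in> carrier (free_alg g). \<forall>u. free_act scale \<rho> p u = 0}"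
  have "ideal I (free_alg g)"
  proof (rule idealI)
    show "ring (free_alg g)" by (rule free_alg_ring)
    have inv: "\<ominus>\<^bsub>free_alg g\<^esub> p = - p" if "p \<in> carrier (free_alg g)" for p
    proof (rule F.minus_equality)
      show "- p \<in> carrier (free_alg g)" using that by (auto simp: free_alg_def in_keys_iff)
    qed (use that in \<open>auto simp: free_alg_def\<close>)
    show "subgroup I (add_monoid (free_alg g))"
    proof (rule group.subgroupI[OF F.a_group])
      show "I \<noteq> {}" using F.zero_closed by (auto simp: I_def free_alg_def intro!: exI[of _ 0])
    next
      fix p assume "p \<in> I"
      then show "inv\<^bsub>add_monoid (free_alg g)\<^esub> p \<in> I"
        using inv[of p] F.a_inv_closed[of p]
        by (auto simp: I_def free_act_uminus a_inv_def)
    next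
      fix p q assume "p \<in> I" "q \<in> I"
      then show "p \<otimes>\<^bsub>add_monoid (free_alg g)\<^esub> q \<in> I"
        using F.a_closed[of p q] by (auto simp: I_def free_act_add) (auto simp: free_alg_def free_act_add)
    qed (auto simp: I_def)
  next
    fix p x assume "p \<in> I" and x: "x \<in> carrier (free_alg g)"
    then have p: "p \<in> carrier (free_alg g)" "\<And>u. free_act scale \<rho> p u = 0" by (auto simp: I_def)
    have z: "free_act scale \<rho> x 0 = 0"
      using free_act_mult[OF x, of 0] by simp
    show "x \<otimes>\<^bsub>free_alg g\<^esub> p \<in> I" "p \<otimes>\<^bsub>free_alg g\<^esub> x \<in> I"
      using F.m_closed[OF x p(1)] F.m_closed[OF p(1) x] free_act_mult[OF x] free_act_mult[OF p(1)] p(2) z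
      by (auto simp: I_def free_alg_def)
  qed
  moreover have "uea_relations g \<subseteq> I"
  proof -
    have "free_act scale \<rho> r u = 0" if "r \<in> uea_relations g" for r u
      using that
      by (auto simp: uea_relations_def free_gen_def free_const_def free_act_diff mult_single
          plus_word_def zero_word_def act_add_left act_smult act_bracket)
    then show ?thesis using uea_relations_closed by (auto simp: I_def)
  qed
  ultimately have "uea_ideal g \<subseteq> I"
    unfolding uea_ideal_def by (rule F.genideal_minimal)
  then show ?thesis using assms by (auto simp: I_def)
qed

lemma uea_act_class:
  assumes p: "p \<in> carrier (free_alg g)"
  shows "uea_act scale \<rho> (uea_ideal g +>\<^bsub>free_alg g\<^esub> p) u = free_act scale \<rho> p u"
proof -
  interpret F: ring "free_alg g" by (rule free_alg_ring)
  interpret ideal "uea_ideal g" "free_alg g"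
    unfolding uea_ideal_def using uea_relations_closed by (rule F.genideal_ideal)
  let ?X = "uea_ideal g +>\<^bsub>free_alg g\<^esub> p"
  have "p \<in> ?X" using p by (rule a_rcos_self)
  then have "(SOME q. q \<in> ?X) \<in> ?X" by (rule someI)
  then obtain i where "i \<in> uea_ideal g" "(SOME q. q \<in> ?X) = i + p"
    by (auto simp: a_r_coset_def' free_alg_def)
  then show ?thesis
    unfolding uea_act_def by (simp add: free_act_add uea_ideal_acts_by_zero)
qed

text \<open>
  By \<open>uea_act_class\<close> any representative may be used to compute the action of a class, and the action
  of a representative is a linear combination of words.
\<close>

theorem canonical_filtration_eq: "canonical_filtration g scale \<rho> v l = filtration v l"
proof -
  interpret F: ring "free_alg g" by (rule free_alg_ring)
  let ?W = "{act_word xs v | xs. set xs \<subseteq> g \<and> length xs \<le> l}"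
  let ?P = "{p \<in> carrier (free_alg g). \<forall>w\<in>Poly_Mapping.keys p. length (letters w) \<le> l}"
  have "uea_filtration g l = (\<lambda>p. uea_ideal g +>\<^bsub>free_alg g\<^esub> p) ` ?P"
  proof -
    have "uea_ideal g +>\<^bsub>free_alg g\<^esub> p \<in> carrier (uea g)" if "p \<in> carrier (free_alg g)" for p
      using that unfolding uea_def FactRing_def A_RCOSETS_def' by auto
    then show ?thesis unfolding uea_filtration_def
      by (intro subset_antisym subsetI) (simp only: mem_Collect_eq image_iff; blast)+
  qed
  then have "canonical_filtration g scale \<rho> v l =
      (\<lambda>p. uea_act scale \<rho> (uea_ideal g +>\<^bsub>free_alg g\<^esub> p) v) ` ?P"
    unfolding canonical_filtration_def by (simp only: Setcompr_eq_image image_image Collect_mem_eq)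
  also have "\<dots> = (\<lambda>p. free_act scale \<rho> p v) ` ?P"
    by (intro image_cong refl uea_act_class) simp
  also have "\<dots> = span ?W"
  proof
    show "(\<lambda>p. free_act scale \<rho> p v) ` ?P \<subseteq> span ?W"
    proof (intro image_subsetI)
      fix p assume "p \<in> ?P"
      then have "act_word (letters w) v \<in> ?W" if "w \<in> Poly_Mapping.keys p" for w
        using that by (auto simp: free_alg_def)
      then show "free_act scale \<rho> p v \<in> span ?W"
        unfolding free_act_def by (intro span_sum span_scale span_base)
    qed
    have "subspace ((\<lambda>p. free_act scale \<rho> p v) ` ?P)"
    proof (rule subspaceI)
      show "0 \<in> (\<lambda>p. free_act scale \<rho> p v) ` ?P"
        by (rule image_eqI[of _ _ 0]) (auto simp: free_alg_def)
    next
      fix x y assume "x \<in> (\<lambda>p. free_act scale \<rho> p v) ` ?P" "y \<in> (\<lambda>p. free_act scale \<rho> p v) ` ?P"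
      then obtain p q where "x = free_act scale \<rho> p v" "y = free_act scale \<rho> q v" "p \<in> ?P" "q \<in> ?P"
        by auto
      then show "x + y \<in> (\<lambda>p. free_act scale \<rho> p v) ` ?P"
        using Poly_Mapping.keys_add[of p q]
        by (intro image_eqI[of _ _ "p + q"]) (simp add: free_act_add, simp add: free_alg_def, blast)
    next
      fix c x assume "x \<in> (\<lambda>p. free_act scale \<rho> p v) ` ?P"
      then obtain p where p: "x = free_act scale \<rho> p v" "p \<in> ?P" by auto
      have "free_const c \<in> carrier (free_alg g)"
        by (auto simp: free_alg_def free_const_def zero_word_def)
      moreover have k: "Poly_Mapping.keys (free_const c * p) \<subseteq> Poly_Mapping.keys p"
        using Poly_Mapping.keys_mult[of "free_const c" p] by (auto simp: free_const_def split: if_splits)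
      ultimately show "scale c x \<in> (\<lambda>p. free_act scale \<rho> p v) ` ?P"
        using p
        by (intro image_eqI[of _ _ "free_const c * p"])
           (auto simp: free_act_mult, auto simp: free_const_def free_alg_def zero_word_def)
    qed
    moreover have "?W \<subseteq> (\<lambda>p. free_act scale \<rho> p v) ` ?P"
    proof
      fix x assume "x \<in> ?W"
      then obtain xs where "x = act_word xs v" "set xs \<subseteq> g" "length xs \<le> l" by auto
      then show "x \<in> (\<lambda>p. free_act scale \<rho> p v) ` ?P"
        by (intro image_eqI[of _ _ "Poly_Mapping.single (Word xs) 1"]) (auto simp: free_alg_def)
    qed
    ultimately show "span ?W \<subseteq> (\<lambda>p. free_act scale \<rho> p v) ` ?P"
      by (intro span_minimal)
  qed
  finally show ?thesis unfolding filtration_def .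
qed

section \<open>Spanning by ordered monomials\<close>

lemma filtration_mono: "k \<le> l \<Longrightarrow> filtration v k \<subseteq> filtration v l"
  unfolding filtration_def by (intro span_mono) auto

lemma act_word_in_filtration: "set xs \<subseteq> g \<Longrightarrow> length xs \<le> l \<Longrightarrow> act_word xs v \<in> filtration v l"
  unfolding filtration_def by (intro span_base) auto

lemma filtration_subspace: "subspace (filtration v l)"
  by (simp add: filtration_def)

lemma act_filtration:
  assumes "x \<in> g" "u \<in> filtration v l"
  shows "\<rho> x u \<in> filtration v (Suc l)"
  using assms(2) unfolding filtration_def
proof (induction rule: span_induct_alt)
  case base
  then show ?case using assms(1) by (simp add: act_zero span_zero)
next
  case (step c w u)
  then obtain xs where "w = act_word xs v" "set xs \<subseteq> g" "length xs \<le> l" by auto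
  then have "\<rho> x w \<in> {act_word xs v |xs. set xs \<subseteq> g \<and> length xs \<le> Suc l}"
    using assms(1) by (auto intro!: exI[of _ "x # xs"])
  then show ?case
    using step assms(1) by (simp add: act_add act_scale span_add span_scale span_base)
qed

text \<open>
  Moving a letter past its left neighbour costs a word in which the two letters are replaced by their
  bracket, and that word is shorter by one.
\<close>

lemma act_word_move:
  assumes "set (ys @ x # zs) \<subseteq> g"
  shows "act_word (ys @ x # zs) v - act_word (x # ys @ zs) v \<in> filtration v (length ys + length zs)"
  using assms
proof (induction ys)
  case Nil
  then show ?case by (simp add: subspace_0[OF filtration_subspace])
next
  case (Cons y ys)
  let ?u = "act_word (ys @ zs) v"
  have g: "x \<in> g" "y \<in> g" using Cons.prems by auto
  have "act_word ((y # ys) @ x # zs) v - act_word (x # (y # ys) @ zs) v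
     = \<rho> y (act_word (ys @ x # zs) v - act_word (x # ys @ zs) v) + \<rho> (lie_bracket y x) ?u"
    using g by (simp add: act_diff act_bracket)
  moreover have "\<rho> y (act_word (ys @ x # zs) v - act_word (x # ys @ zs) v)
      \<in> filtration v (length (y # ys) + length zs)"
    using Cons g by (simp add: act_filtration)
  moreover have "\<rho> (lie_bracket y x) ?u \<in> filtration v (length (y # ys) + length zs)"
    using Cons.prems g act_word_in_filtration[of "ys @ zs" "length ys + length zs" v]
    by (auto intro!: act_filtration bracket_closed)
  ultimately show ?case
    by (simp only: subspace_add[OF filtration_subspace])
qed

lemma act_word_permute:
  assumes "mset xs = mset ys" "set xs \<subseteq> g"
  shows "act_word xs v - act_word ys v \<in> filtration v (length xs - 1)"
  using assms
proof (induction xs arbitrary: ys)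
  case Nil
  then show ?case by (simp add: subspace_0[OF filtration_subspace])
next
  case (Cons x xs)
  then have "x \<in> set ys" by (metis list.set_intros(1) set_mset_mset)
  then obtain us ws where ys: "ys = us @ x # ws" by (meson split_list)
  have m: "mset xs = mset (us @ ws)" using Cons.prems(1) ys by simp
  have set_ys: "set ys \<subseteq> g" using Cons.prems by (metis set_mset_mset)
  have "length xs = length us + length ws" using arg_cong[OF m, of size] by simp
  then have move: "act_word ys v - act_word (x # us @ ws) v \<in> filtration v (length xs)"
    using act_word_move[of us x ws v] set_ys by (simp add: ys)
  have "\<rho> x (act_word xs v - act_word (us @ ws) v) \<in> filtration v (length xs)"
  proof (cases xs)
    case Nil
    then show ?thesis
      using m Cons.prems by (simp add: act_zero subspace_0[OF filtration_subspace])
  next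
    case (Cons a as)
    then show ?thesis
      using act_filtration[OF _ Cons.IH[OF m], of x] Cons.prems by simp
  qed
  moreover have "act_word (x # xs) v - act_word ys v
      = \<rho> x (act_word xs v - act_word (us @ ws) v) - (act_word ys v - act_word (x # us @ ws) v)"
    using Cons.prems by (simp add: act_diff)
  ultimately show ?case
    using move by (simp only: subspace_diff[OF filtration_subspace] length_Cons diff_Suc_1)
qed

text \<open>
  Modulo shorter words the letter can be moved to the right end of the word, where it acts on
  \<open>v\<close> by a scalar.
\<close>

lemma act_stabilizer:
  assumes "x \<in> g" "\<rho> x v = scale c v" "set xs \<subseteq> g"
  shows "\<rho> x (act_word xs v) \<in> filtration v (length xs)"
proof -
  have "act_word (x # xs) v - act_word (xs @ [x]) v \<in> filtration v (length xs)"
    using act_word_permute[of "x # xs" "xs @ [x]" v] assms by simp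
  moreover have "act_word (xs @ [x]) v \<in> filtration v (length xs)"
    using assms act_word_in_filtration[of xs "length xs" v]
    by (simp add: act_word_scale subspace_scale[OF filtration_subspace])
  ultimately show ?thesis
    using subspace_add[OF filtration_subspace] by fastforce
qed

definition ordered_monomial :: "('i::linorder \<Rightarrow> 'k mat) \<Rightarrow> 'v \<Rightarrow> 'i multiset \<Rightarrow> 'v" where
  "ordered_monomial z v X = act_word (map z (sorted_list_of_multiset X)) v"

text \<open>
  Going from \<open>l\<close> to \<open>l + 1\<close> means applying one more \<open>x \<in> g\<close> to an ordered monomial. Its part \<open>y\<close>, which
  stabilises the line of \<open>v\<close>, does not raise the length, and each \<open>z i\<close> gives an unordered monomial,
  which can be sorted modulo shorter words.
\<close>

theorem filtration_eq_span_ordered_monomials: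
  fixes z :: "'i::linorder \<Rightarrow> 'k mat"
  assumes z: "z ` I \<subseteq> g"
    and split: "\<And>x. x \<in> g \<Longrightarrow> \<exists>y\<in>g. \<exists>a c. \<rho> y v = scale a v \<and>
                  (\<forall>u. \<rho> x u = \<rho> y u + (\<Sum>i\<in>I. scale (c i) (\<rho> (z i) u)))"
  shows "filtration v l = span (ordered_monomial z v ` {X. set_mset X \<subseteq> I \<and> size X \<le> l})"
    (is "_ = span (?M l)")
proof
  have "ordered_monomial z v X \<in> filtration v l" if "set_mset X \<subseteq> I" "size X \<le> l" for X
    using that z unfolding ordered_monomial_def
    by (intro act_word_in_filtration) (auto, metis mset_sorted_list_of_multiset size_mset)
  then show "span (?M l) \<subseteq> filtration v l"
    by (intro span_minimal filtration_subspace) auto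
next
  show "filtration v l \<subseteq> span (?M l)"
  proof (induction l)
    case 0
    have "act_word xs v \<in> ?M 0" if "length xs \<le> 0" for xs
      using that by (intro image_eqI[of _ _ "{#}"]) (auto simp: ordered_monomial_def)
    then show ?case unfolding filtration_def by (intro span_mono) blast
  next
    case (Suc l)
    have mono: "span (?M l) \<subseteq> span (?M (Suc l))" by (intro span_mono) auto
    have step: "\<rho> x (ordered_monomial z v X) \<in> span (?M (Suc l))"
      if x: "x \<in> g" and X: "set_mset X \<subseteq> I" "size X \<le> l" for x X
    proof -
      let ?xs = "map z (sorted_list_of_multiset X)" and ?u = "ordered_monomial z v X"
      have len: "length ?xs = size X" by (metis length_map mset_sorted_list_of_multiset size_mset)
      have xs: "set ?xs \<subseteq> g" using X z by auto
      have low: "w \<in> span (?M (Suc l))" if "w \<in> filtration v (size X)" for w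
        using that Suc.IH mono filtration_mono[OF X(2), of v] by blast
      obtain y a c where y: "y \<in> g" "\<rho> y v = scale a v"
        and sum: "\<And>u. \<rho> x u = \<rho> y u + (\<Sum>i\<in>I. scale (c i) (\<rho> (z i) u))"
        using split[OF x] by blast
      have "\<rho> (z i) ?u \<in> span (?M (Suc l))" if i: "i \<in> I" for i
      proof -
        let ?ys = "map z (sorted_list_of_multiset (add_mset i X))"
        have "mset (z i # ?xs) = mset ?ys" by simp
        then have "act_word (z i # ?xs) v - act_word ?ys v \<in> filtration v (size X)"
          using act_word_permute[of "z i # ?xs" ?ys v] xs i z len by auto
        then have "\<rho> (z i) ?u - ordered_monomial z v (add_mset i X) \<in> span (?M (Suc l))"
          using low by (simp add: ordered_monomial_def)
        moreover have "ordered_monomial z v (add_mset i X) \<in> span (?M (Suc l))"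
          using X i by (intro span_base imageI) auto
        ultimately show ?thesis using span_add by fastforce
      qed
      moreover have "\<rho> y ?u \<in> span (?M (Suc l))"
        using act_stabilizer[OF y xs] low len by (simp add: ordered_monomial_def)
      ultimately show ?thesis by (simp add: sum span_add span_sum span_scale)
    qed
    have stable: "\<rho> x u \<in> span (?M (Suc l))" if "x \<in> g" "u \<in> span (?M l)" for x u
      using that(2)
    proof (induction rule: span_induct_alt)
      case base
      then show ?case using that(1) by (simp add: act_zero span_zero)
    next
      case (step c w u)
      then show ?case
        using that(1) \<open>\<And>X x. _ \<Longrightarrow> _ \<Longrightarrow> _ \<Longrightarrow> \<rho> x (ordered_monomial z v X) \<in> _\<close>
        by (auto simp: act_add act_scale intro!: span_add span_scale)
    qed
    have "act_word xs v \<in> span (?M (Suc l))" if xs: "set xs \<subseteq> g" "length xs \<le> Suc l" for xs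
    proof (cases xs)
      case Nil
      then have "act_word xs v = ordered_monomial z v {#}" by (simp add: ordered_monomial_def)
      then show ?thesis by (metis (mono_tags, lifting) empty_subsetI image_eqI le0 mem_Collect_eq
            set_mset_empty size_empty span_base)
    next
      case (Cons x ys)
      then have "act_word ys v \<in> span (?M l)"
        using xs Suc.IH act_word_in_filtration[of ys l v] by auto
      then show ?thesis using stable xs Cons by simp
    qed
    then show ?case unfolding filtration_def by (intro span_minimal) auto
  qed
qed

end

section \<open>Highest weight modules of the general linear Lie algebra\<close>

text \<open>
  The action is given by operators \<open>e i j\<close> that stand for the matrix units, with the matrix indices
  bounded by \<open>N\<close>. No matrices occur, so that the same notion covers \<open>L(\<lambda>)\<close>, the Fock
  space below and the product of the two.
\<close>

locale gl_module = vector_space scale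
  for scale :: "'k::field_char_0 \<Rightarrow> 'v::ab_group_add \<Rightarrow> 'v" +
  fixes N :: nat and e :: "nat \<Rightarrow> nat \<Rightarrow> 'v \<Rightarrow> 'v"
  assumes e_add: "i < N \<Longrightarrow> j < N \<Longrightarrow> e i j (u + w) = e i j u + e i j w"
    and e_scale: "i < N \<Longrightarrow> j < N \<Longrightarrow> e i j (scale c u) = scale c (e i j u)"
    and e_commutator: "i < N \<Longrightarrow> j < N \<Longrightarrow> k < N \<Longrightarrow> l < N \<Longrightarrow>
      e i j (e k l u) - e k l (e i j u)
        = (if j = k then e i l u else 0) - (if l = i then e k j u else 0)"
begin

lemma
  assumes "i < N" "j < N"
  shows e_zero: "e i j 0 = 0"
    and e_sum: "e i j (sum f I) = (\<Sum>t\<in>I. e i j (f t))"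
proof -
  show zero: "e i j 0 = 0" using e_scale[OF assms, of 0 0] by simp
  show "e i j (sum f I) = (\<Sum>t\<in>I. e i j (f t))"
    by (induction I rule: infinite_finite_induct) (auto simp: zero e_add assms)
qed

definition e_word :: "(nat \<times> nat) list \<Rightarrow> 'v \<Rightarrow> 'v" where
  "e_word xs u = foldr (\<lambda>(i, j). e i j) xs u"

lemma e_word_Nil [simp]: "e_word [] u = u"
  and e_word_Cons [simp]: "e_word (x # xs) u = e (fst x) (snd x) (e_word xs u)"
  and e_word_append: "e_word (xs @ ys) u = e_word xs (e_word ys u)"
  by (auto simp: e_word_def split_beta)

lemma e_word_scale:
    "set xs \<subseteq> {..<N} \<times> {..<N} \<Longrightarrow> e_word xs (scale c u) = scale c (e_word xs u)"
  and e_word_sum: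
    "set xs \<subseteq> {..<N} \<times> {..<N} \<Longrightarrow> e_word xs (sum f I) = (\<Sum>t\<in>I. e_word xs (f t))"
  by (induction xs) (auto simp: e_scale e_sum)

lemma e_word_zero: "set xs \<subseteq> {..<N} \<times> {..<N} \<Longrightarrow> e_word xs 0 = 0"
  by (induction xs) (auto simp: e_zero)

end

locale gl_highest_weight = gl_module +
  fixes v :: 'b and wt :: "nat \<Rightarrow> 'a"
  assumes e_raise: "i < j \<Longrightarrow> j < N \<Longrightarrow> e i j v = 0"
    and e_diag: "i < N \<Longrightarrow> e i i v = scale (wt i) v"
begin

definition lower_pairs :: "(nat \<times> nat) set" where
  "lower_pairs = {(i, j). j < i \<and> i < N}"

text \<open>
  Everything below the line of \<open>v\<close> in the submodule generated by \<open>v\<close>.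
\<close>

definition lower_part :: "'b set" where
  "lower_part = span {e_word ys v | ys. set ys \<subseteq> lower_pairs \<and> ys \<noteq> []}"

text \<open>
  Words in the operators below the diagonal, applied to \<open>v\<close>, span a submodule: an operator on or above
  the diagonal is commuted through the word until it meets \<open>v\<close>, and each commutator leaves a shorter
  word.
\<close>

lemma e_stable_lower_words:
  assumes "i < N" "j < N" "u \<in> span {e_word ys v | ys. set ys \<subseteq> lower_pairs}"
  shows "e i j u \<in> span {e_word ys v | ys. set ys \<subseteq> lower_pairs}" (is "_ \<in> ?M")
proof -
  have lin: "e i j u \<in> ?M" if "i < N" "j < N" "u \<in> ?M"
    and "\<And>ys. set ys \<subseteq> lower_pairs \<Longrightarrow> e i j (e_word ys v) \<in> ?M" for i j u
    using that(3)
  proof (induction rule: span_induct_alt)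
    case base
    then show ?case using that by (simp add: e_zero span_zero)
  next
    case (step c w u)
    then show ?case using that by (auto simp: e_add e_scale intro!: span_add span_scale)
  qed
  have low: "e i j u \<in> ?M" if "(i, j) \<in> lower_pairs" "u \<in> ?M" for i j u
  proof (rule lin)
    show "i < N" "j < N" using that by (auto simp: lower_pairs_def)
    fix ys assume "set ys \<subseteq> lower_pairs"
    then show "e i j (e_word ys v) \<in> ?M"
      using that by (intro span_base) (auto intro!: exI[of _ "(i, j) # ys"])
  qed (fact that)
  have "e i j (e_word ys v) \<in> ?M" if "i < N" "j < N" "set ys \<subseteq> lower_pairs" for i j ys
    using that
  proof (induction ys arbitrary: i j)
    case Nil
    have "v \<in> ?M" by (intro span_base) (auto intro!: exI[of _ "[]"])
    then show ?case
      using Nil e_raise[of i j] e_diag[of i] low[of i j v]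
      by (cases i j rule: linorder_cases) (auto simp: span_zero span_scale lower_pairs_def)
  next
    case (Cons x ys)
    obtain k l where x: "x = (k, l)" by (cases x)
    have kl: "(k, l) \<in> lower_pairs" "k < N" "l < N"
      using Cons.prems x by (auto simp: lower_pairs_def)
    let ?u = "e_word ys v"
    have "e i j (e_word (x # ys) v)
        = e k l (e i j ?u) + ((if j = k then e i l ?u else 0) - (if l = i then e k j ?u else 0))"
      using e_commutator[of i j k l ?u] Cons.prems kl x by (simp add: algebra_simps)
    also have "\<dots> \<in> ?M"
    proof -
      have "e i' j' ?u \<in> ?M" if "i' < N" "j' < N" for i' j'
        using Cons.IH[OF that] Cons.prems by simp
      then have "e k l (e i j ?u) \<in> ?M" "(if j = k then e i l ?u else 0) \<in> ?M"
        "(if l = i then e k j ?u else 0) \<in> ?M"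
        using Cons.prems kl low by (auto simp: span_zero)
      then show ?thesis by (intro span_add span_diff)
    qed
    finally show ?case .
  qed
  then show ?thesis using lin assms by blast
qed

lemma e_word_lower:
  assumes "set xs \<subseteq> {..<N} \<times> {..<N}"
  shows "e_word xs v \<in> span {e_word ys v | ys. set ys \<subseteq> lower_pairs}"
  using assms
proof (induction xs)
  case Nil
  show ?case by (intro span_base) (auto intro!: exI[of _ "[]"])
next
  case (Cons x xs)
  then show ?case using e_stable_lower_words[of "fst x" "snd x"] by auto
qed

lemma vacuum_coefficient_exists:
  assumes "set xs \<subseteq> {..<N} \<times> {..<N}"
  shows "\<exists>c. e_word xs v - scale c v \<in> lower_part"
  using e_word_lower[OF assms]
proof (induction rule: span_induct_alt)
  case base
  show ?case by (intro exI[of _ 0]) (simp add: lower_part_def span_zero)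
next
  case (step a w u)
  then obtain c ys where c: "u - scale c v \<in> lower_part" and w: "w = e_word ys v" "set ys \<subseteq> lower_pairs"
    by auto
  show ?case
  proof (cases "ys = []")
    case True
    then have "scale a w + u - scale (a + c) v = u - scale c v"
      using w by (simp add: scale_left_distrib)
    then show ?thesis using c by metis
  next
    case False
    then have "w \<in> lower_part" unfolding lower_part_def using w by (intro span_base) auto
    then have "scale a w + (u - scale c v) \<in> lower_part"
      using c unfolding lower_part_def by (intro span_add span_scale)
    then show ?thesis by (metis add_diff_eq)
  qed
qed

text \<open>
  The operator \<open>H\<close>, the action of \<open>diag(0, 1, \<dots>, N - 1)\<close>, has the eigenvalue \<open>w0\<close> on \<open>v\<close> and the
  eigenvalue \<open>w0 + h\<close> on a lower word, with \<open>h > 0\<close> the sum of the \<open>i - j\<close> over its letters. The product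
  \<open>Q T\<close> of the \<open>H - w0 - t\<close> for \<open>1 \<le> t < T\<close> kills the words with \<open>h < T\<close> but not \<open>v\<close>.
\<close>

lemma highest_weight_vector_not_lower:
  assumes "v \<noteq> 0"
  shows "v \<notin> lower_part"
proof
  assume v: "v \<in> lower_part"
  define H where "H u = (\<Sum>i<N. scale (of_nat i) (e i i u))" for u
  define w0 where "w0 = (\<Sum>i<N. of_nat i * wt i)"
  define height :: "(nat \<times> nat) list \<Rightarrow> nat" where "height ys = (\<Sum>(i, j)\<leftarrow>ys. i - j)" for ys
  have H_add: "H (u + w) = H u + H w" and H_scale: "H (scale c u) = scale c (H u)" for u w c
    by (auto simp: H_def e_add e_scale scale_right_distrib sum.distrib scale_sum_right
        mult.commute intro!: sum.cong)
  have H_comm: "H (e k l u) = e k l (H u) + scale (of_nat k - of_nat l) (e k l u)"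
    if "k < N" "l < N" for k l u
  proof -
    have "H (e k l u) - e k l (H u) = (\<Sum>i<N. scale (of_nat i) (e i i (e k l u) - e k l (e i i u)))"
      using that by (simp add: H_def e_sum e_scale scale_right_diff_distrib sum_subtractf)
    also have "\<dots> = (\<Sum>i<N. (if i = k then scale (of_nat i) (e i l u) else 0)
        - (if i = l then scale (of_nat i) (e k i u) else 0))"
      using that by (intro sum.cong refl) (auto simp: e_commutator scale_right_diff_distrib)
    also have "\<dots> = scale (of_nat k - of_nat l) (e k l u)"
      using that by (simp add: sum_subtractf scale_left_diff_distrib)
    finally show ?thesis by (simp add: algebra_simps)
  qed
  have eigen: "H (e_word ys v) = scale (w0 + of_nat (height ys)) (e_word ys v)"
    if "set ys \<subseteq> lower_pairs" for ys
    using that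
  proof (induction ys)
    case Nil
    then show ?case by (simp add: H_def w0_def height_def e_diag scale_sum_left)
  next
    case (Cons y ys)
    then obtain k l where y: "y = (k, l)" "l < k" "k < N" by (auto simp: lower_pairs_def)
    have "H (e_word (y # ys) v)
        = scale (w0 + of_nat (height ys)) (e_word (y # ys) v) + scale (of_nat k - of_nat l) (e_word (y # ys) v)"
      using Cons y by (simp add: H_comm e_scale)
    also have "\<dots> = scale (w0 + of_nat (height (y # ys))) (e_word (y # ys) v)"
    proof -
      have "w0 + of_nat (height ys) + (of_nat k - of_nat l) = w0 + of_nat (height (y # ys))"
        using y by (simp add: height_def of_nat_diff)
      then show ?thesis by (simp only: scale_left_distrib[symmetric])
    qed
    finally show ?case .
  qed
  define Q where "Q T u = foldr (\<lambda>t u. H u - scale (w0 + of_nat t) u) [1..<T] u" for T u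
  have Q_add: "Q T (u + w) = Q T u + Q T w" and Q_scale: "Q T (scale c u) = scale c (Q T u)"
    for T u w c
  proof -
    have "foldr (\<lambda>t u. H u - scale (w0 + of_nat t) u) ts (u + w)
        = foldr (\<lambda>t u. H u - scale (w0 + of_nat t) u) ts u
          + foldr (\<lambda>t u. H u - scale (w0 + of_nat t) u) ts w" for ts :: "nat list"
      by (induction ts) (auto simp: H_add scale_right_distrib)
    moreover have "foldr (\<lambda>t u. H u - scale (w0 + of_nat t) u) ts (scale c u)
        = scale c (foldr (\<lambda>t u. H u - scale (w0 + of_nat t) u) ts u)" for ts :: "nat list"
      by (induction ts) (auto simp: H_scale scale_right_diff_distrib mult.commute)
    ultimately show "Q T (u + w) = Q T u + Q T w" "Q T (scale c u) = scale c (Q T u)"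
      by (simp_all add: Q_def)
  qed
  have Q_eigen: "Q T u = scale (\<Prod>t\<leftarrow>[1..<T]. of_nat h - of_nat t) u"
    if "H u = scale (w0 + of_nat h) u" for T u h
  proof -
    have "foldr (\<lambda>t u. H u - scale (w0 + of_nat t) u) ts u
        = scale (\<Prod>t\<leftarrow>ts. of_nat h - of_nat t) u" for ts :: "nat list"
    proof (induction ts)
      case (Cons t ts)
      let ?p = "\<Prod>t\<leftarrow>ts. of_nat h - of_nat t :: 'a"
      have "?p * (w0 + of_nat h) - (w0 + of_nat t) * ?p = (of_nat h - of_nat t) * ?p"
        by (simp add: algebra_simps)
      then show ?case
        using Cons by (simp add: H_scale that scale_left_diff_distrib[symmetric])
    qed simp
    then show ?thesis by (simp add: Q_def)
  qed
  have "\<exists>T. \<forall>T'\<ge>T. Q T' v = 0"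
    using v unfolding lower_part_def
  proof (induction rule: span_induct_alt)
    case base
    have "Q T 0 = 0" for T using Q_scale[of T 0 0] by simp
    then show ?case by blast
  next
    case (step c w u)
    then obtain ys T where ys: "w = e_word ys v" "set ys \<subseteq> lower_pairs" "ys \<noteq> []"
      and T: "\<forall>T'\<ge>T. Q T' u = 0" by auto
    have "height ys > 0"
      using ys(2,3) by (cases ys) (auto simp: height_def lower_pairs_def)
    then have "Q T' w = 0" if "T' > height ys" for T'
      using that Q_eigen[OF eigen[OF ys(2)], of T']
      by (auto simp: ys(1) prod_list_zero_iff)
    then show ?case
      using T by (intro exI[of _ "max T (Suc (height ys))"]) (auto simp: Q_add Q_scale)
  qed
  then obtain T where "Q T v = 0" by blast
  moreover have "Q T v = scale (\<Prod>t\<leftarrow>[1..<T]. of_nat 0 - of_nat t) v"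
    using eigen[of "[]"] by (intro Q_eigen) (simp add: height_def)
  moreover have "(\<Prod>t\<leftarrow>[1..<T]. of_nat 0 - of_nat t) \<noteq> (0 :: 'a)"
    by (auto simp: prod_list_zero_iff)
  ultimately show False using assms by simp
qed

text \<open>
  The coefficient of the highest weight vector in a word depends only on the weight, not on the
  module: it is enough to apply \<open>vacuum_coefficient_exists\<close> once, to the vector \<open>(v, v')\<close> of the product of
  the two modules, which is again a highest weight vector of the same weight.
\<close>

lemma common_vacuum_coefficient:
  fixes scale' :: "'a \<Rightarrow> 'c::ab_group_add \<Rightarrow> 'c"
  assumes "gl_highest_weight scale' N e' v' wt"
    and xs: "set xs \<subseteq> {..<N} \<times> {..<N}"
  shows "\<exists>c. e_word xs v - scale c v \<in> lower_part \<and>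
     gl_module.e_word e' xs v' - scale' c v' \<in> gl_highest_weight.lower_part scale' N e' v'"
proof -
  interpret V: gl_highest_weight scale' N e' v' wt by fact
  let ?s = "\<lambda>c. map_prod (scale c) (scale' c)" and ?e = "\<lambda>i j. map_prod (e i j) (e' i j)"
  have vs: "vector_space ?s"
    by unfold_locales
       (simp_all add: map_prod_def scale_right_distrib V.scale_right_distrib scale_left_distrib
         V.scale_left_distrib split_beta)
  interpret P: gl_highest_weight ?s N ?e "(v, v')" wt
  proof (intro gl_highest_weight.intro gl_module.intro vs gl_module_axioms.intro
      gl_highest_weight_axioms.intro)
    fix i j k l u assume "i < N" "j < N" "k < N" "l < N"
    then show "?e i j (?e k l u) - ?e k l (?e i j u)
        = (if j = k then ?e i l u else 0) - (if l = i then ?e k j u else 0)"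
      using e_commutator[of i j k l "fst u"] V.e_commutator[of i j k l "snd u"]
      by (cases u) (simp add: zero_prod_def)
  next
    fix i j u w assume "i < N" "j < N"
    then show "?e i j (u + w) = ?e i j u + ?e i j w"
      by (cases u; cases w) (simp add: e_add V.e_add)
  next
    fix i j c u assume "i < N" "j < N"
    then show "?e i j (?s c u) = ?s c (?e i j u)"
      by (cases u) (simp add: e_scale V.e_scale)
  next
    fix i j assume "i < j" "j < N"
    then show "?e i j (v, v') = 0" by (simp add: e_raise V.e_raise zero_prod_def)
  next
    fix i assume "i < N"
    then show "?e i i (v, v') = ?s (wt i) (v, v')" by (simp add: e_diag V.e_diag)
  qed
  have word: "P.e_word ys (u, u') = (e_word ys u, V.e_word ys u')" for ys u u'
    by (induction ys) auto
  obtain c where c: "P.e_word xs (v, v') - ?s c (v, v') \<in> P.lower_part"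
    using P.vacuum_coefficient_exists[OF xs] by blast
  have "fst u \<in> lower_part \<and> snd u \<in> V.lower_part" if "u \<in> P.lower_part" for u
    using that unfolding P.lower_part_def
  proof (induction rule: P.span_induct_alt)
    case base
    then show ?case by (simp add: lower_part_def V.lower_part_def span_zero V.span_zero)
  next
    case (step a w u)
    then obtain ys where "w = (e_word ys v, V.e_word ys v')" "set ys \<subseteq> P.lower_pairs" "ys \<noteq> []"
      unfolding word by blast
    then have "fst w \<in> lower_part" "snd w \<in> V.lower_part"
      unfolding lower_part_def V.lower_part_def
      by (auto intro!: span_base V.span_base)
    then have "scale a (fst w) + fst u \<in> lower_part" "scale' a (snd w) + snd u \<in> V.lower_part"
      using step.IH unfolding lower_part_def V.lower_part_def
      by (intro span_add span_scale V.span_add V.span_scale; simp)+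
    then show ?case by (cases u; cases w) simp
  qed
  from this[OF c] show ?thesis by (auto simp: word)
qed

end

section \<open>Fermionic Fock space\<close>

lemma sum_fun_apply: "sum F I x = (\<Sum>t\<in>I. F t x)"
  by (induction I rule: infinite_finite_induct) auto

text \<open>
  A function on sets of modes assigns coefficients to the monomials of an exterior algebra whose
  generators are the modes \<open>'q\<close>, taken in the order given by \<open>to_nat\<close>. The sign is the cost of moving
  the generator \<open>p\<close> to the front. Counting the modes before \<open>p\<close>, rather than after it, keeps the count finite for
  every set \<open>S\<close>. The operators \<open>create p\<close> and \<open>annihilate p\<close> are exterior multiplication by \<open>p\<close> and
  contraction with it.
\<close>

definition fock_sign :: "'q::countable \<Rightarrow> 'q set \<Rightarrow> 'f::comm_ring_1" where
  "fock_sign p S = (-1) ^ card {q \<in> S. to_nat q < to_nat p}"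

definition annihilate :: "'q::countable \<Rightarrow> ('q set \<Rightarrow> 'f::comm_ring_1) \<Rightarrow> 'q set \<Rightarrow> 'f" where
  "annihilate p f = (\<lambda>S. if p \<in> S then 0 else fock_sign p S * f (insert p S))"

definition create :: "'q::countable \<Rightarrow> ('q set \<Rightarrow> 'f::comm_ring_1) \<Rightarrow> 'q set \<Rightarrow> 'f" where
  "create p f = (\<lambda>S. if p \<in> S then fock_sign p S * f (S - {p}) else 0)"

definition hop :: "'q::countable \<Rightarrow> 'q \<Rightarrow> ('q set \<Rightarrow> 'f::comm_ring_1) \<Rightarrow> 'q set \<Rightarrow> 'f" where
  "hop p q f = create p (annihilate q f)"

lemma finite_lower_modes: "finite {q \<in> S. to_nat q < to_nat p}" for p :: "'q::countable"
  by (rule finite_subset[of _ "to_nat -` {..<to_nat p}"]) (auto intro: finite_vimageI)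

lemma fock_sign_insert:
  assumes "q \<notin> S"
  shows "fock_sign p (insert q S) = (if to_nat q < to_nat p then - fock_sign p S else fock_sign p S :: 'f::comm_ring_1)"
proof -
  have "{x \<in> insert q S. to_nat x < to_nat p}
      = (if to_nat q < to_nat p then insert q {x \<in> S. to_nat x < to_nat p} else {x \<in> S. to_nat x < to_nat p})"
    by auto
  then show ?thesis using assms finite_lower_modes[of S p] by (simp add: fock_sign_def)
qed

lemma fock_sign_remove:
  assumes "q \<in> S"
  shows "fock_sign p (S - {q}) = (if to_nat q < to_nat p then - fock_sign p S else fock_sign p S :: 'f::comm_ring_1)"
proof -
  have "fock_sign p S = (if to_nat q < to_nat p then - fock_sign p (S - {q}) else fock_sign p (S - {q}) :: 'f)"
    using assms by (subst insert_Diff[OF assms, symmetric]) (simp add: fock_sign_insert del: insert_Diff_single)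
  then show ?thesis by simp
qed

lemma fock_sign_self [simp]:
  "fock_sign p (insert p S) = fock_sign p S" "fock_sign p (S - {p}) = fock_sign p S"
proof -
  have "{q \<in> insert p S. to_nat q < to_nat p} = {q \<in> S. to_nat q < to_nat p}"
    "{q \<in> S - {p}. to_nat q < to_nat p} = {q \<in> S. to_nat q < to_nat p}" by auto
  then show "fock_sign p (insert p S) = fock_sign p S" "fock_sign p (S - {p}) = fock_sign p S"
    by (simp_all add: fock_sign_def)
qed

lemma fock_sign_square: "fock_sign p S * fock_sign p S = 1"
  by (simp add: fock_sign_def power_add[symmetric] mult_2[symmetric])

lemma fock_sign_square_left [simp]: "fock_sign p S * (fock_sign p S * x) = x"
  by (simp add: mult.assoc[symmetric] fock_sign_square)

lemma to_nat_cases: "p \<noteq> q \<Longrightarrow> to_nat p < to_nat q \<or> to_nat q < to_nat p" for p q :: "'q::countable"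
  by (metis linorder_neqE_nat to_nat_split)

text \<open>
  The next three lemmas are the canonical anticommutation relations. The commutator of two hops follows
  from them alone.
\<close>

lemma annihilate_annihilate: "annihilate p (annihilate q f) = - annihilate q (annihilate p f)"
proof
  fix S
  show "annihilate p (annihilate q f) S = (- annihilate q (annihilate p f)) S"
    using to_nat_cases[of p q]
    by (cases "p = q") (auto simp: annihilate_def fock_sign_insert insert_commute)
qed

lemma create_create: "create p (create q f) = - create q (create p f)"
proof
  fix S
  have "S - {p} - {q} = S - {q} - {p}" by auto
  then show "create p (create q f) S = (- create q (create p f)) S"
    using to_nat_cases[of p q]
    by (cases "p = q") (auto simp: create_def fock_sign_remove)
qed

lemma annihilate_create: "annihilate p (create q f) = (if p = q then f else 0) - create q (annihilate p f)"
proof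
  fix S
  have "q \<noteq> p \<Longrightarrow> insert p S - {q} = insert p (S - {q})" by auto
  then show "annihilate p (create q f) S = ((if p = q then f else 0) - create q (annihilate p f)) S"
    using to_nat_cases[of p q]
    by (cases "p = q")
       (auto simp: annihilate_def create_def fock_sign_insert fock_sign_remove insert_absorb)
qed

lemma annihilate_linear:
  "annihilate p (f + g) = annihilate p f + annihilate p g" "annihilate p (- f) = - annihilate p f"
  "annihilate p (\<lambda>S. c * f S) = (\<lambda>S. c * annihilate p f S)" "annihilate p 0 = 0"
  by (auto simp: annihilate_def fun_eq_iff algebra_simps)

lemma create_linear:
  "create p (f + g) = create p f + create p g" "create p (- f) = - create p f"
  "create p (\<lambda>S. c * f S) = (\<lambda>S. c * create p f S)" "create p 0 = 0"
  by (auto simp: create_def fun_eq_iff algebra_simps)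

lemma hop_linear:
  "hop p q (f + g) = hop p q f + hop p q g"
  "hop p q (\<lambda>S. c * f S) = (\<lambda>S. c * hop p q f S)" "hop p q 0 = 0"
  by (simp_all add: hop_def annihilate_linear create_linear)

lemma hop_sum: "hop p q (sum F I) = (\<Sum>t\<in>I. hop p q (F t))"
  by (induction I rule: infinite_finite_induct)
     (simp_all only: sum.infinite sum.empty sum.insert hop_linear not_False_eq_True)

lemma hop_commutator:
  "hop p q (hop r s f) - hop r s (hop p q f)
     = (if q = r then hop p s f else 0) - (if s = p then hop r q f else 0)"
proof -
  have prod: "hop p q (hop r s f)
      = (if q = r then hop p s f else 0) - create p (create r (annihilate q (annihilate s f)))"
    for p q r s
    using create_linear(1)[of p "if q = r then annihilate s f else 0"
        "- create r (annihilate q (annihilate s f))"]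
    by (simp add: hop_def annihilate_create create_linear)
  have "create r (create p (annihilate s (annihilate q f)))
      = create p (create r (annihilate q (annihilate s f)))"
    by (simp add: create_create[of r p] annihilate_annihilate[of s q] create_linear)
  then show ?thesis by (simp add: prod)
qed

lemma hop_of_int: "hop p q (\<lambda>S. of_int (f S)) = (\<lambda>S. of_int (hop p q f S))"
  by (auto simp: hop_def create_def annihilate_def fock_sign_def fun_eq_iff)

lemma hop_apply:
  "hop p q f S = (if p \<in> S \<and> q \<notin> S - {p}
     then fock_sign p S * fock_sign q (S - {p}) * f (insert q (S - {p})) else 0)"
  by (simp add: hop_def create_def annihilate_def mult.assoc)

text \<open>
  A mode \<open>(m, i)\<close> is the basis vector \<open>i\<close> of the copy \<open>m\<close> of \<open>V\<close>; the matrix unit acts as a derivation,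
  on one copy (leg) at a time.
\<close>

definition fock_e :: "'m::countable set \<Rightarrow> nat \<Rightarrow> nat \<Rightarrow> (('m \<times> nat) set \<Rightarrow> 'f::comm_ring_1) \<Rightarrow> ('m \<times> nat) set \<Rightarrow> 'f"
  where "fock_e Legs i j f = (\<Sum>m\<in>Legs. hop (m, i) (m, j) f)"

lemma fock_e_of_int: "fock_e Legs i j (\<lambda>S. of_int (f S)) = (\<lambda>S. of_int (fock_e Legs i j f S))"
  by (simp add: fock_e_def hop_of_int fun_eq_iff sum_fun_apply)

lemma fock_e_linear:
  "fock_e Legs i j (f + g) = fock_e Legs i j f + fock_e Legs i j g"
  "fock_e Legs i j (\<lambda>S. c * f S) = (\<lambda>S. c * fock_e Legs i j f S)"
  by (simp_all add: fock_e_def hop_linear sum.distrib fun_eq_iff sum_fun_apply sum_distrib_left)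

lemma fock_e_commutator:
  assumes "finite Legs"
  shows "fock_e Legs i j (fock_e Legs k l f) - fock_e Legs k l (fock_e Legs i j f)
    = (if j = k then fock_e Legs i l f else 0) - (if l = i then fock_e Legs k j f else 0)"
proof -
  have "fock_e Legs i j (fock_e Legs k l f) - fock_e Legs k l (fock_e Legs i j f)
     = (\<Sum>m\<in>Legs. \<Sum>m'\<in>Legs. hop (m, i) (m, j) (hop (m', k) (m', l) f))
       - (\<Sum>m'\<in>Legs. \<Sum>m\<in>Legs. hop (m', k) (m', l) (hop (m, i) (m, j) f))"
    by (simp add: fock_e_def hop_sum)
  also have "\<dots> = (\<Sum>m\<in>Legs. \<Sum>m'\<in>Legs. hop (m, i) (m, j) (hop (m', k) (m', l) f)
       - hop (m', k) (m', l) (hop (m, i) (m, j) f))"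
    by (subst sum.swap[of _ Legs Legs], simp add: sum_subtractf)
  also have "\<dots> = (\<Sum>m\<in>Legs. \<Sum>m'\<in>Legs. if m = m' then
       (if j = k then hop (m, i) (m, l) f else 0) - (if l = i then hop (m, k) (m, j) f else 0) else 0)"
    by (intro sum.cong refl) (simp add: hop_commutator)
  also have "\<dots> = (if j = k then fock_e Legs i l f else 0) - (if l = i then fock_e Legs k j f else 0)"
    using assms by (simp add: fock_e_def sum_subtractf)
  finally show ?thesis .
qed

text \<open>
  The sum is restricted to the subsets of the finite set \<open>\<Omega>\<close> of modes that are in use, since the modes
  range over an infinite type.
\<close>

definition fock_inner :: "'q set \<Rightarrow> ('q set \<Rightarrow> 'f::comm_ring_1) \<Rightarrow> ('q set \<Rightarrow> 'f) \<Rightarrow> 'f" where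
  "fock_inner \<Omega> f g = (\<Sum>S\<in>Pow \<Omega>. f S * g S)"

lemma fock_inner_linear:
  "fock_inner \<Omega> f (g + h) = fock_inner \<Omega> f g + fock_inner \<Omega> f h"
  "fock_inner \<Omega> f (g - h) = fock_inner \<Omega> f g - fock_inner \<Omega> f h"
  "fock_inner \<Omega> f (\<lambda>S. c * g S) = c * fock_inner \<Omega> f g"
  "fock_inner \<Omega> f (sum G I) = (\<Sum>t\<in>I. fock_inner \<Omega> f (G t))"
proof -
  show "fock_inner \<Omega> f (g + h) = fock_inner \<Omega> f g + fock_inner \<Omega> f h"
   "fock_inner \<Omega> f (g - h) = fock_inner \<Omega> f g - fock_inner \<Omega> f h"
   "fock_inner \<Omega> f (\<lambda>S. c * g S) = c * fock_inner \<Omega> f g"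
    by (simp_all add: fock_inner_def algebra_simps sum.distrib sum_subtractf sum_distrib_left)
  show "fock_inner \<Omega> f (sum G I) = (\<Sum>t\<in>I. fock_inner \<Omega> f (G t))"
    unfolding fock_inner_def by (subst sum.swap) (simp add: sum_fun_apply sum_distrib_left)
qed

lemma fock_inner_commute: "fock_inner \<Omega> f g = fock_inner \<Omega> g f"
  by (simp add: fock_inner_def mult.commute)

text \<open>
  Inserting and removing \<open>p\<close> is a bijection between the sets that avoid \<open>p\<close> and those that contain it.
\<close>

lemma fock_inner_create:
  assumes "finite \<Omega>" "p \<in> \<Omega>"
  shows "fock_inner \<Omega> (create p f) g = fock_inner \<Omega> f (annihilate p g)"
proof -
  have "fock_inner \<Omega> (create p f) g = (\<Sum>S\<in>{S \<in> Pow \<Omega>. p \<in> S}. fock_sign p S * f (S - {p}) * g S)"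
    unfolding fock_inner_def create_def using assms
    by (subst sum.inter_filter) (auto intro!: sum.cong)
  also have "\<dots> = (\<Sum>S\<in>{S \<in> Pow \<Omega>. p \<notin> S}. f S * (fock_sign p S * g (insert p S)))"
    by (rule sum.reindex_bij_witness[where i = "insert p" and j = "\<lambda>S. S - {p}"])
       (use assms in \<open>auto simp: insert_absorb\<close>)
  also have "\<dots> = fock_inner \<Omega> f (annihilate p g)"
    unfolding fock_inner_def annihilate_def using assms
    by (subst sum.inter_filter) (auto intro!: sum.cong)
  finally show ?thesis .
qed

lemma fock_inner_hop:
  assumes "finite \<Omega>" "p \<in> \<Omega>" "q \<in> \<Omega>"
  shows "fock_inner \<Omega> (hop p q f) g = fock_inner \<Omega> f (hop q p g)"
proof -
  have "fock_inner \<Omega> (hop p q f) g = fock_inner \<Omega> (annihilate q f) (annihilate p g)"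
    using assms by (simp add: hop_def fock_inner_create)
  also have "\<dots> = fock_inner \<Omega> (hop q p g) f"
    using assms
    by (subst fock_inner_commute[of \<Omega> "annihilate q f"]) (simp only: hop_def fock_inner_create)
  finally show ?thesis by (simp only: fock_inner_commute)
qed

lemma fock_inner_e:
  assumes "finite Legs" "i < N" "j < N"
  shows "fock_inner (Legs \<times> {..<N}) (fock_e Legs i j f) g
       = fock_inner (Legs \<times> {..<N}) f (fock_e Legs j i g)"
proof -
  have "fock_inner (Legs \<times> {..<N}) (fock_e Legs i j f) g
      = (\<Sum>m\<in>Legs. fock_inner (Legs \<times> {..<N}) (hop (m, i) (m, j) f) g)"
    by (simp add: fock_e_def fock_inner_commute[of _ _ g] fock_inner_linear)
  also have "\<dots> = fock_inner (Legs \<times> {..<N}) f (fock_e Legs j i g)"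
    using assms by (simp add: fock_e_def fock_inner_linear fock_inner_hop)
  finally show ?thesis .
qed

text \<open>
  The modes occupied in the highest weight vector: the first \<open>r m\<close> basis vectors on the leg \<open>m\<close>, that
  is, a highest weight vector of the exterior power of degree \<open>r m\<close>.
\<close>

definition ground_config :: "'m set \<Rightarrow> ('m \<Rightarrow> nat) \<Rightarrow> ('m \<times> nat) set" where
  "ground_config Legs r = {(m, i). m \<in> Legs \<and> i < r m}"

definition ground_state :: "'m set \<Rightarrow> ('m \<Rightarrow> nat) \<Rightarrow> ('m \<times> nat) set \<Rightarrow> 'f::comm_ring_1" where
  "ground_state Legs r = (\<lambda>S. if S = ground_config Legs r then 1 else 0)"

text \<open>
  Below an occupied mode of a leg every mode is occupied, so there is no free place to hop down to.
\<close>

lemma hop_ground_raise: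
  assumes "i < j"
  shows "hop (m, i) (m, j) (ground_state Legs r) = (0 :: _ \<Rightarrow> 'f::comm_ring_1)"
proof
  fix S
  have False if "insert (m, j) (S - {(m, i)}) = ground_config Legs r"
  proof -
    have "(m, j) \<in> ground_config Legs r" using that by blast
    then have "(m, i) \<in> ground_config Legs r" using assms by (auto simp: ground_config_def)
    then show False using that assms by auto
  qed
  then show "hop (m, i) (m, j) (ground_state Legs r) S = (0 :: _ \<Rightarrow> 'f) S"
    by (auto simp: hop_apply ground_state_def)
qed

lemma hop_ground_diag:
  assumes "m \<in> Legs"
  shows "hop (m, i) (m, i) (ground_state Legs r) = (if i < r m then ground_state Legs r else 0)"
  using assms
  by (auto simp: hop_apply ground_state_def ground_config_def fun_eq_iff insert_absorb fock_sign_square)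

lemma fock_highest_weight:
  fixes Legs :: "'m::countable set"
  assumes "finite Legs"
  shows "gl_highest_weight (\<lambda>(c :: 'f::field_char_0) f S. c * f S) N (fock_e Legs)
    (ground_state Legs r) (\<lambda>i. of_nat (card {m \<in> Legs. i < r m}))"
proof (intro gl_highest_weight.intro gl_module.intro gl_module_axioms.intro
    gl_highest_weight_axioms.intro fock_e_commutator assms fock_e_linear)
  show "vector_space (\<lambda>(c :: 'f) (f :: ('m \<times> nat) set \<Rightarrow> 'f) S. c * f S)"
    by unfold_locales (auto simp: fun_eq_iff algebra_simps)
  show "fock_e Legs i j (ground_state Legs r) = (0 :: _ \<Rightarrow> 'f)" if "i < j" for i j
    using that by (simp add: fock_e_def hop_ground_raise)
  show "fock_e Legs i i (ground_state Legs r)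
      = (\<lambda>S. of_nat (card {m \<in> Legs. i < r m}) * (ground_state Legs r S :: 'f))" for i
    using assms
    by (simp add: fock_e_def hop_ground_diag fun_eq_iff sum_fun_apply sum.If_cases if_distrib
        if_distribR Int_def)
qed

section \<open>Independence of words in Fock space\<close>

definition fock_word :: "'m::countable set \<Rightarrow> (nat \<times> nat) list \<Rightarrow> (('m \<times> nat) set \<Rightarrow> 'f::comm_ring_1) \<Rightarrow> ('m \<times> nat) set \<Rightarrow> 'f"
  where "fock_word Legs xs f = foldr (\<lambda>(i, j). fock_e Legs i j) xs f"

text \<open>
  A triple \<open>(m, i, j)\<close> is the hop from mode \<open>j\<close> to mode \<open>i\<close> on the leg \<open>m\<close>. Up to sign, \<open>hops\<close> follows the
  configuration of occupied modes, which \<open>move\<close> describes.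
\<close>

definition hops :: "('m::countable \<times> nat \<times> nat) list \<Rightarrow> (('m \<times> nat) set \<Rightarrow> 'f::comm_ring_1) \<Rightarrow> ('m \<times> nat) set \<Rightarrow> 'f"
  where "hops zs f = foldr (\<lambda>(m, i, j). hop (m, i) (m, j)) zs f"

definition move :: "'m \<times> nat \<times> nat \<Rightarrow> ('m \<times> nat) set \<Rightarrow> ('m \<times> nat) set" where
  "move = (\<lambda>(m, i, j) S. insert (m, i) (S - {(m, j)}))"

lemma move_apply: "move (m, i, j) S = insert (m, i) (S - {(m, j)})"
  by (simp add: move_def)

lemma hops_Nil [simp]: "hops [] f = f"
  and hops_Cons [simp]: "hops ((m, x) # zs) f = hop (m, fst x) (m, snd x) (hops zs f)"
  by (auto simp: hops_def split_beta)

lemma fock_word_Nil [simp]: "fock_word Legs [] f = f"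
  and fock_word_Cons [simp]: "fock_word Legs (x # xs) f = fock_e Legs (fst x) (snd x) (fock_word Legs xs f)"
  by (auto simp: fock_word_def split_beta)

lemma fock_word_of_int:
  "fock_word Legs xs (\<lambda>S. of_int (f S)) = (\<lambda>S. of_int (fock_word Legs xs f S))"
  by (induction xs) (auto simp: fock_e_of_int)

text \<open>
  Each letter of the word chooses the leg on which it acts.
\<close>

lemma fock_word_expand:
  assumes "finite Legs"
  shows "fock_word Legs xs f = (\<Sum>ms | set ms \<subseteq> Legs \<and> length ms = length xs. hops (zip ms xs) f)"
proof (induction xs)
  case Nil
  have "{ms. set ms \<subseteq> Legs \<and> length ms = length []} = {[]}" by auto
  then show ?case by simp
next
  case (Cons x xs)
  let ?L = "\<lambda>n. {ms. set ms \<subseteq> Legs \<and> length ms = n}"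
  have "fock_word Legs (x # xs) f
      = (\<Sum>m\<in>Legs. \<Sum>ms\<in>?L (length xs). hops (zip (m # ms) (x # xs)) f)"
    by (simp add: Cons.IH fock_e_def hop_sum)
  also have "\<dots> = (\<Sum>ms\<in>(\<lambda>(m, ms). m # ms) ` (Legs \<times> ?L (length xs)). hops (zip ms (x # xs)) f)"
    by (subst sum.reindex) (auto simp: inj_on_def sum.cartesian_product split_beta)
  also have "(\<lambda>(m, ms). m # ms) ` (Legs \<times> ?L (length xs)) = ?L (length (x # xs))"
    by (auto simp: length_Suc_conv image_iff)
  finally show ?case .
qed

lemma hop_concentrated:
  assumes "\<And>S. S \<noteq> T \<Longrightarrow> f S = 0" and "S \<noteq> insert p (T - {q})"
  shows "hop p q f S = 0"
proof (rule ccontr)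
  assume "hop p q f S \<noteq> 0"
  then have S: "p \<in> S" "q \<notin> S - {p}" and "f (insert q (S - {p})) \<noteq> 0"
    by (auto simp: hop_apply split: if_splits)
  then have "insert q (S - {p}) = T" using assms(1)[of "insert q (S - {p})"] by (simp, metis)
  then have "S = insert p (T - {q})" using S by auto
  then show False using assms(2) by simp
qed

lemma hop_value:
  assumes "q \<in> T" "p \<notin> T"
  shows "hop p q f (insert p (T - {q}))
    = fock_sign p (insert p (T - {q})) * fock_sign q (T - {q}) * f T"
proof -
  have "insert p (T - {q}) - {p} = T - {q}" "insert q (T - {q}) = T" using assms by auto
  then show ?thesis using assms by (auto simp: hop_apply)
qed

text \<open>
  The ground state is a basis vector, and a hop maps a basis vector to a multiple of a basis vector.
\<close>

lemma hops_concentrated: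
  assumes "S \<noteq> foldr move zs (ground_config Legs r)"
  shows "hops zs (ground_state Legs r) S = 0"
  using assms
proof (induction zs arbitrary: S)
  case Nil
  then show ?case by (simp add: ground_state_def)
next
  case (Cons z zs)
  obtain m i j where z: "z = (m, i, j)" by (cases z)
  show ?case
    unfolding z hops_Cons
    by (rule hop_concentrated[OF Cons.IH]) (use Cons.prems z in \<open>auto simp: move_def\<close>)
qed

text \<open>
  The set \<open>{i. (m, i) \<in> S}\<close> is the configuration on the leg \<open>m\<close>; a move changes only that of its own leg.
\<close>

lemma move_slice:
  "{i. (m, i) \<in> move (m', x) S}
    = (if m = m' then insert (fst x) ({i. (m, i) \<in> S} - {snd x}) else {i. (m, i) \<in> S})"
  by (cases x) (auto simp: move_def)

lemma moves_slice_untouched: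
  assumes "m \<in> Legs" "m \<notin> fst ` set zs"
  shows "{i. (m, i) \<in> foldr move zs (ground_config Legs r)} = {..<r m}"
  using assms
proof (induction zs)
  case (Cons z zs)
  then show ?case by (cases z) (simp add: move_slice)
qed (auto simp: ground_config_def)

lemma moves_slice:
  assumes "m \<in> Legs" "distinct (map fst zs)" "(m, x) \<in> set zs"
  shows "{i. (m, i) \<in> foldr move zs (ground_config Legs r)} = insert (fst x) ({..<r m} - {snd x})"
  using assms
proof (induction zs)
  case (Cons z zs)
  obtain m' y where z: "z = (m', y)" by (cases z)
  show ?case
  proof (cases "m = m'")
    case True
    then have "x = y" "m \<notin> fst ` set zs"
      using Cons.prems z by force+
    then show ?thesis
      using Cons.prems True z by (simp add: move_slice moves_slice_untouched)
  next
    case False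
    then show ?thesis using Cons z by (auto simp: move_slice)
  qed
qed simp

text \<open>
  Every leg is used at most once, and every hop starts at a mode that is occupied in the ground state
  and ends at a free one. Such hops cannot interfere with one another.
\<close>

definition admissible :: "('m \<Rightarrow> nat) \<Rightarrow> ('m \<times> nat \<times> nat) list \<Rightarrow> bool" where
  "admissible r zs \<longleftrightarrow> distinct (map fst zs) \<and> (\<forall>(m, i, j) \<in> set zs. j < r m \<and> r m \<le> i)"

lemma hops_ground_nonzero:
  assumes "admissible r zs" "fst ` set zs \<subseteq> Legs"
  shows "hops zs (ground_state Legs r) (foldr move zs (ground_config Legs r)) \<noteq> (0 :: 'f::field_char_0)"
  using assms
proof (induction zs)
  case Nil
  then show ?case by (simp add: ground_state_def)
next
  case (Cons z zs)
  obtain m i j where z: "z = (m, i, j)" by (cases z)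
  let ?T = "foldr move zs (ground_config Legs r)"
  have zs: "admissible r zs" using Cons.prems(1) by (auto simp: admissible_def)
  have m: "m \<in> Legs" "m \<notin> fst ` set zs" "j < r m" "r m \<le> i"
    using Cons.prems z by (auto simp: admissible_def)
  have "(m, n) \<in> ?T \<longleftrightarrow> n < r m" for n
    using moves_slice_untouched[OF m(1,2), of r] by (simp add: set_eq_iff)
  then have "(m, j) \<in> ?T" "(m, i) \<notin> ?T" using m(3,4) by simp_all
  then have "hops (z # zs) (ground_state Legs r) (insert (m, i) (?T - {(m, j)}))
      = (fock_sign (m, i) (insert (m, i) (?T - {(m, j)})) * fock_sign (m, j) (?T - {(m, j)}) :: 'f)
        * hops zs (ground_state Legs r) ?T"
    by (simp add: z hop_value)
  moreover have "fock_sign p S \<noteq> (0 :: 'f)" for p :: "'a \<times> nat" and S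
    by (simp add: fock_sign_def)
  moreover have "hops zs (ground_state Legs r) ?T \<noteq> (0 :: 'f)"
    using Cons.IH[OF zs] Cons.prems by simp
  ultimately show ?case by (simp add: z move_apply)
qed

text \<open>
  In the configuration on the right every leg of \<open>bs\<close> differs from the ground state, so each of them occurs in \<open>ms\<close>. As
  \<open>ms\<close> is not longer than \<open>bs\<close>, it uses exactly these legs, each of them once, and the mode that was vacated and the
  mode that was filled on a leg determine the hop.
\<close>

lemma moves_determine_word:
  assumes ms: "set ms \<subseteq> Legs" "length ms = length xs"
    and bs: "set bs \<subseteq> Legs" "length bs = length ys" "admissible r (zip bs ys)"
    and len: "length xs \<le> length ys"
    and eq: "foldr move (zip ms xs) (ground_config Legs r) = foldr move (zip bs ys) (ground_config Legs r)"
  shows "mset (zip ms xs) = mset (zip bs ys)"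
proof -
  have db: "distinct bs" using bs by (simp add: admissible_def)
  have "set bs \<subseteq> set ms"
  proof
    fix b assume b: "b \<in> set bs"
    then obtain x where x: "(b, x) \<in> set (zip bs ys)"
      using bs(2) by (metis in_set_impl_in_set_zip1)
    show "b \<in> set ms"
    proof (rule ccontr)
      assume "b \<notin> set ms"
      then have "b \<notin> fst ` set (zip ms xs)" by (auto dest: set_zip_leftD)
      then have "{..<r b} = insert (fst x) ({..<r b} - {snd x})"
        using moves_slice_untouched[of b Legs "zip ms xs" r] moves_slice[of b Legs "zip bs ys" x r]
          b bs x db eq by auto
      moreover have "fst x \<notin> {..<r b}" using bs(3) x by (auto simp: admissible_def)
      ultimately show False by blast
    qed
  qed
  moreover have "card (set bs) = length bs" using db by (rule distinct_card)
  moreover have "card (set ms) \<le> length ms" by (rule card_length)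
  ultimately have eqset: "set bs = set ms" and "card (set ms) = length ms" and lens: "length ms = length bs"
    using ms(2) bs(2) len card_mono[of "set ms" "set bs"] card_seteq[of "set ms" "set bs"] by auto
  then have dm: "distinct ms" by (simp add: card_distinct)
  have "set (zip ms xs) \<subseteq> set (zip bs ys)"
  proof
    fix z assume z: "z \<in> set (zip ms xs)"
    obtain m x where mx: "z = (m, x)" by (cases z)
    have "m \<in> set bs" using z mx eqset by (auto dest: set_zip_leftD)
    then obtain y where y: "(m, y) \<in> set (zip bs ys)"
      using bs(2) by (metis in_set_impl_in_set_zip1)
    have "insert (fst x) ({..<r m} - {snd x}) = insert (fst y) ({..<r m} - {snd y})"
      using moves_slice[of m Legs "zip ms xs" x r] moves_slice[of m Legs "zip bs ys" y r]
        z mx y dm db bs(1) ms \<open>m \<in> set bs\<close> bs(2) eq by auto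
    moreover have "snd y < r m" "r m \<le> fst y" using bs(3) y by (auto simp: admissible_def)
    ultimately have "fst x = fst y" "snd x = snd y" by (auto simp: set_eq_iff) (metis leD)+
    then have "x = y" by (simp add: prod_eq_iff)
    then show "z \<in> set (zip bs ys)" using mx y by simp
  qed
  moreover have "distinct (zip ms xs)" "distinct (zip bs ys)"
    using dm db by (auto intro: distinct_zipI1)
  moreover have "card (set (zip ms xs)) = card (set (zip bs ys))"
    using lens ms(2) bs(2) \<open>distinct (zip ms xs)\<close> \<open>distinct (zip bs ys)\<close>
    by (simp add: distinct_card)
  ultimately show ?thesis
    by (metis List.finite_set card_subset_eq set_eq_iff_mset_eq_distinct)
qed

text \<open>
  Hops on different legs commute.
\<close>

lemma hops_permute:
  assumes "mset zs = mset zs'" "distinct (map fst zs)"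
  shows "hops zs f = hops zs' f"
proof -
  let ?h = "\<lambda>(m, i, j). hop (m, i) (m, j) :: (_ \<Rightarrow> 'b) \<Rightarrow> _"
  have "?h x \<circ> ?h y = ?h y \<circ> ?h x" if "x \<in> set zs" "y \<in> set zs" for x y
  proof (cases "x = y")
    case False
    then have "fst x \<noteq> fst y"
      using assms(2) that by (auto simp: distinct_map inj_on_def)
    then have "?h x (?h y f) - ?h y (?h x f) = 0" for f
      by (cases x; cases y) (simp add: hop_commutator)
    then show ?thesis by (simp add: fun_eq_iff)
  qed simp
  then have "fold ?h (rev zs) = fold ?h (rev zs')"
    using assms(1) by (intro fold_multiset_equiv) auto
  then show ?thesis by (simp add: hops_def foldr_conv_fold)
qed

text \<open>
  By \<open>moves_determine_word\<close> only those choices of legs contribute that rearrange the chosen hops, and by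
  \<open>hops_permute\<close> all of them contribute the same vector, so that no cancellation can occur.
\<close>

lemma fock_word_coefficient:
  fixes Legs :: "'m::countable set"
  assumes fin: "finite Legs"
    and bs: "set bs \<subseteq> Legs" "length bs = length ys" "admissible r (zip bs ys)"
    and len: "length xs \<le> length ys"
  shows "fock_word Legs xs (ground_state Legs r) (foldr move (zip bs ys) (ground_config Legs r))
    = of_nat (card {ms. set ms \<subseteq> Legs \<and> length ms = length xs \<and> mset (zip ms xs) = mset (zip bs ys)})
      * (hops (zip bs ys) (ground_state Legs r) (foldr move (zip bs ys) (ground_config Legs r))
          :: 'f::comm_ring_1)"
proof -
  let ?T = "foldr move (zip bs ys) (ground_config Legs r)" and ?f = "ground_state Legs r :: _ \<Rightarrow> 'f"
  let ?L = "{ms. set ms \<subseteq> Legs \<and> length ms = length xs}"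
  have finL: "finite ?L" using fin by (rule finite_lists_length_eq)
  have "hops (zip ms xs) ?f ?T = (if mset (zip ms xs) = mset (zip bs ys) then hops (zip bs ys) ?f ?T else 0)"
    if "ms \<in> ?L" for ms
  proof (cases "mset (zip ms xs) = mset (zip bs ys)")
    case True
    then have "mset (map fst (zip ms xs)) = mset (map fst (zip bs ys))" by (simp only: mset_map)
    then have "distinct (map fst (zip ms xs))"
      using bs(3) mset_eq_imp_distinct_iff unfolding admissible_def by blast
    then show ?thesis using True hops_permute[OF True, of ?f] by simp
  next
    case False
    then have "?T \<noteq> foldr move (zip ms xs) (ground_config Legs r)"
      using moves_determine_word[OF _ _ bs len] that by (metis (mono_tags, lifting) mem_Collect_eq)
    then show ?thesis using False by (simp add: hops_concentrated)
  qed
  then have "fock_word Legs xs ?f ?T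
      = (\<Sum>ms\<in>?L. if mset (zip ms xs) = mset (zip bs ys) then hops (zip bs ys) ?f ?T else 0)"
    by (simp add: fock_word_expand[OF fin] sum_fun_apply)
  also have "\<dots> = of_nat (card {ms \<in> ?L. mset (zip ms xs) = mset (zip bs ys)}) * hops (zip bs ys) ?f ?T"
    using finL by (simp add: sum.If_cases Int_def)
  finally show ?thesis by (simp add: conj_assoc)
qed

text \<open>
  Among the words with a nonzero coefficient take a longest one, \<open>w\<close>. The configuration \<open>?T\<close> obtained from \<open>w\<close> by
  letting its letters act on distinct legs occurs in \<open>w\<close>, but in no other word of \<open>X\<close> whose length is at
  most that of \<open>w\<close>, because the words of \<open>X\<close> differ as multisets.
\<close>

theorem fock_words_independent:
  fixes Legs :: "'m::countable set" and c :: "(nat \<times> nat) list \<Rightarrow> 'f::field_char_0"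
  assumes fin: "finite Legs" "finite X"
    and inj: "inj_on mset X"
    and legs: "\<And>ys. ys \<in> X \<Longrightarrow> \<exists>bs. set bs \<subseteq> Legs \<and> length bs = length ys \<and> admissible r (zip bs ys)"
    and bound: "\<And>m. m \<in> Legs \<Longrightarrow> r m \<le> N" "\<And>ys. ys \<in> X \<Longrightarrow> set ys \<subseteq> {..<N} \<times> {..<N}"
    and zero: "\<And>S. S \<subseteq> Legs \<times> {..<N} \<Longrightarrow> (\<Sum>xs\<in>X. c xs * fock_word Legs xs (ground_state Legs r) S) = 0"
    and "ys \<in> X"
  shows "c ys = 0"
proof (rule ccontr)
  assume "c ys \<noteq> 0"
  define Y where "Y = {ys \<in> X. c ys \<noteq> 0}"
  have "finite Y" "Y \<noteq> {}" using fin \<open>ys \<in> X\<close> \<open>c ys \<noteq> 0\<close> by (auto simp: Y_def)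
  then have "Max (length ` Y) \<in> length ` Y" by (intro Max_in) auto
  then obtain w where w: "w \<in> Y" "length w = Max (length ` Y)" by auto
  then have maxw: "length xs \<le> length w" if "xs \<in> Y" for xs
    using that \<open>finite Y\<close> by simp
  have wX: "w \<in> X" "c w \<noteq> 0" using w by (auto simp: Y_def)
  obtain bs where bs: "set bs \<subseteq> Legs" "length bs = length w" "admissible r (zip bs w)"
    using legs wX by blast
  let ?T = "foldr move (zip bs w) (ground_config Legs r)" and ?f = "ground_state Legs r :: _ \<Rightarrow> 'f"
  have "?T \<subseteq> Legs \<times> {..<N}"
  proof -
    have "foldr move zs (ground_config Legs r) \<subseteq> Legs \<times> {..<N}"
      if "set zs \<subseteq> Legs \<times> {..<N} \<times> {..<N}" for zs
      using that by (induction zs) (use bound(1) in \<open>force simp: ground_config_def move_def\<close>)+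
    moreover have "set (zip bs w) \<subseteq> Legs \<times> {..<N} \<times> {..<N}"
      using bs(1) bound(2)[OF wX(1)] by (auto dest: set_zip_leftD set_zip_rightD)
    ultimately show ?thesis by blast
  qed
  then have "0 = (\<Sum>xs\<in>X. c xs * fock_word Legs xs ?f ?T)" using zero by simp
  also have "\<dots> = (\<Sum>xs\<in>X. if xs = w then c w * fock_word Legs w ?f ?T else 0)"
  proof (intro sum.cong refl)
    fix xs assume xs: "xs \<in> X"
    show "c xs * fock_word Legs xs ?f ?T = (if xs = w then c w * fock_word Legs w ?f ?T else 0)"
    proof (cases "c xs = 0 \<or> xs = w")
      case False
      then have len: "length xs \<le> length w" using maxw xs by (auto simp: Y_def)
      have "mset xs \<noteq> mset w" using inj xs wX False by (auto dest: inj_onD)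
      then have "mset (zip ms xs) \<noteq> mset (zip bs w)" if "length ms = length xs" for ms
        using that bs(2) by (metis map_snd_zip mset_map)
      then have none: "{ms. set ms \<subseteq> Legs \<and> length ms = length xs \<and> mset (zip ms xs) = mset (zip bs w)} = {}"
        by blast
      show ?thesis
        using False by (simp add: fock_word_coefficient[OF fin(1) bs len] none)
    qed (use wX in auto)
  qed
  also have "\<dots> = c w * fock_word Legs w ?f ?T" using fin wX by simp
  also have "\<dots> \<noteq> 0"
  proof -
    let ?A = "{ms. set ms \<subseteq> Legs \<and> length ms = length w \<and> mset (zip ms w) = mset (zip bs w)}"
    have "finite ?A" by (rule finite_subset[OF _ finite_lists_length_eq[OF fin(1), of "length w"]]) auto
    moreover have "bs \<in> ?A" using bs by simp
    ultimately have "card ?A \<noteq> 0" by auto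
    moreover have "fst ` set (zip bs w) \<subseteq> Legs" using bs(1) by (auto dest: set_zip_leftD)
    ultimately show ?thesis
      using wX hops_ground_nonzero[OF bs(3), of Legs]
      by (simp add: fock_word_coefficient[OF fin(1) bs])
  qed
  finally show False by simp
qed

section \<open>Independence of words in a highest weight module\<close>

text \<open>
  The determinant of an integer matrix is an integer, so its vanishing does not depend on the field of
  characteristic zero over which the matrix is considered.
\<close>

lemma int_matrix_nonsingular_transfer:
  fixes G :: "'i \<Rightarrow> 'i \<Rightarrow> int" and c :: "'i \<Rightarrow> 'k::field_char_0"
  assumes fin: "finite I"
    and rat: "\<And>d :: 'i \<Rightarrow> rat. (\<And>y. y \<in> I \<Longrightarrow> (\<Sum>x\<in>I. d x * of_int (G x y)) = 0) \<Longrightarrow> (\<And>x. x \<in> I \<Longrightarrow> d x = 0)"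
    and c: "\<And>y. y \<in> I \<Longrightarrow> (\<Sum>x\<in>I. c x * of_int (G x y)) = 0"
    and "x \<in> I"
  shows "c x = 0"
proof -
  define n where "n = card I"
  obtain h where h: "bij_betw h {0..<n} I"
    using ex_bij_betw_nat_finite[OF fin] n_def by blast
  define A :: "int mat" where "A = mat n n (\<lambda>(i, j). G (h j) (h i))"
  have A: "A \<in> carrier_mat n n" by (simp add: A_def)
  have row: "(map_mat of_int A *\<^sub>v vec n (\<lambda>j. d (h j))) $ i = (\<Sum>x\<in>I. d x * of_int (G x (h i)))"
    if "i < n" for i and d :: "'i \<Rightarrow> 'f::comm_ring_1"
    using that sum.reindex_bij_betw[OF h, of "\<lambda>x. d x * of_int (G x (h i))"]
    by (simp add: A_def scalar_prod_def mult.commute)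
  have "det (map_mat of_int A :: rat mat) \<noteq> 0"
  proof
    assume "det (map_mat of_int A :: rat mat) = 0"
    then obtain u :: "rat vec" where u: "u \<in> carrier_vec n" "u \<noteq> 0\<^sub>v n" "map_mat of_int A *\<^sub>v u = 0\<^sub>v n"
      using A det_0_iff_vec_prod_zero[of "map_mat of_int A :: rat mat" n] by auto
    define d where "d x = u $ inv_into {0..<n} h x" for x
    have dh: "d (h j) = u $ j" if "j < n" for j
      using that bij_betw_inv_into_left[OF h] by (simp add: d_def)
    then have uvec: "u = vec n (\<lambda>j. d (h j))" using u(1) by auto
    have "(\<Sum>x\<in>I. d x * of_int (G x y)) = 0" if y: "y \<in> I" for y
    proof -
      obtain i where i: "i < n" "y = h i" using y h by (auto simp: bij_betw_def)
      then show ?thesis using row[of i d] u(3) uvec by simp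
    qed
    then have "d x = 0" if "x \<in> I" for x using rat that by blast
    then have "u $ j = 0" if "j < n" for j
      using that h dh[OF that] by (metis atLeastLessThan_iff bij_betwE le0)
    then show False using u(1,2) by auto
  qed
  then have "det A \<noteq> 0" by simp
  then have "det (map_mat of_int A :: 'k mat) \<noteq> 0" by simp
  moreover have "map_mat of_int A *\<^sub>v vec n (\<lambda>j. c (h j)) = 0\<^sub>v n"
  proof (rule eq_vecI)
    fix i assume "i < dim_vec (0\<^sub>v n :: 'k vec)"
    then have "i < n" by simp
    moreover have "h i \<in> I" using h \<open>i < n\<close> by (auto simp: bij_betw_def)
    ultimately show "(map_mat of_int A *\<^sub>v vec n (\<lambda>j. c (h j))) $ i = 0\<^sub>v n $ i"
      using row[of i c] c by simp
  qed (simp add: A_def)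
  moreover have "map_mat of_int A \<in> carrier_mat n n" using A by simp
  ultimately have "vec n (\<lambda>j. c (h j)) = 0\<^sub>v n"
    using det_0_iff_vec_prod_zero[of "map_mat of_int A :: 'k mat" n] vec_carrier by blast
  then have "c (h j) = 0" if "j < n" for j
    using that by (metis index_vec index_zero_vec(1))
  then show ?thesis using \<open>x \<in> I\<close> h by (auto simp: bij_betw_def)
qed

definition transpose_word :: "(nat \<times> nat) list \<Rightarrow> (nat \<times> nat) list" where
  "transpose_word xs = rev (map prod.swap xs)"

lemma fock_inner_word:
  assumes "finite Legs" "set xs \<subseteq> {..<N} \<times> {..<N}"
  shows "fock_inner (Legs \<times> {..<N}) (fock_word Legs xs f) g
       = fock_inner (Legs \<times> {..<N}) f (fock_word Legs (transpose_word xs) g)"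
  using assms(2)
proof (induction xs arbitrary: g)
  case Nil
  then show ?case by (simp add: transpose_word_def)
next
  case (Cons x xs)
  have "fock_word Legs (transpose_word (x # xs)) g
      = fock_word Legs (transpose_word xs) (fock_e Legs (snd x) (fst x) g)"
    by (simp add: transpose_word_def fock_word_def split_beta)
  then show ?case
    using Cons assms(1) by (auto simp: fock_inner_e)
qed

text \<open>
  The Gram matrix is defined over the integers; \<open>gram_of_int\<close> gives its meaning over other rings.
\<close>

definition gram :: "'m::countable set \<Rightarrow> ('m \<Rightarrow> nat) \<Rightarrow> nat \<Rightarrow> (nat \<times> nat) list \<Rightarrow> (nat \<times> nat) list \<Rightarrow> int" where
  "gram Legs r N xs ys = fock_inner (Legs \<times> {..<N})
     (fock_word Legs xs (ground_state Legs r)) (fock_word Legs ys (ground_state Legs r))"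

lemma fock_inner_of_int:
  "fock_inner \<Omega> (\<lambda>S. of_int (f S)) (\<lambda>S. of_int (g S)) = of_int (fock_inner \<Omega> f g)"
  by (simp add: fock_inner_def)

lemma fock_word_ground_of_int:
  "(fock_word Legs xs (ground_state Legs r) :: _ \<Rightarrow> 'f::comm_ring_1)
     = (\<lambda>S. of_int (fock_word Legs xs (ground_state Legs r) S))"
proof -
  have "(ground_state Legs r :: _ \<Rightarrow> 'f) = (\<lambda>S. of_int (ground_state Legs r S))"
    by (auto simp: ground_state_def)
  then show ?thesis by (simp only: fock_word_of_int)
qed

lemma gram_of_int:
  "fock_inner (Legs \<times> {..<N}) (fock_word Legs xs (ground_state Legs r))
     (fock_word Legs ys (ground_state Legs r)) = of_int (gram Legs r N xs ys)"
  using fock_inner_of_int[of "Legs \<times> {..<N}" "fock_word Legs xs (ground_state Legs r)"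
      "fock_word Legs ys (ground_state Legs r)"]
  by (simp add: gram_def fock_word_ground_of_int[symmetric])

text \<open>
  If the Gram matrix kills \<open>d\<close>, then the combination \<open>f\<close> of the words with coefficients \<open>d\<close> is orthogonal
  to every word, in particular to itself. Over the rationals this gives \<open>f = 0\<close>, since \<open>f\<close> has a sum of squares
  equal to zero.
\<close>

lemma gram_nonsingular:
  fixes Legs :: "'m::countable set" and d :: "(nat \<times> nat) list \<Rightarrow> rat"
  assumes fin: "finite Legs" "finite X"
    and inj: "inj_on mset X"
    and legs: "\<And>ys. ys \<in> X \<Longrightarrow> \<exists>bs. set bs \<subseteq> Legs \<and> length bs = length ys \<and> admissible r (zip bs ys)"
    and bound: "\<And>m. m \<in> Legs \<Longrightarrow> r m \<le> N" "\<And>ys. ys \<in> X \<Longrightarrow> set ys \<subseteq> {..<N} \<times> {..<N}"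
    and zero: "\<And>ys. ys \<in> X \<Longrightarrow> (\<Sum>xs\<in>X. d xs * of_int (gram Legs r N xs ys)) = 0"
    and "xs \<in> X"
  shows "d xs = 0"
proof -
  define f where "f = (\<lambda>S. \<Sum>xs\<in>X. d xs * fock_word Legs xs (ground_state Legs r) S)"
  have f: "f = (\<Sum>xs\<in>X. (\<lambda>S. d xs * fock_word Legs xs (ground_state Legs r) S))"
    by (simp add: f_def fun_eq_iff sum_fun_apply)
  have orth: "fock_inner (Legs \<times> {..<N}) (fock_word Legs ys (ground_state Legs r)) f = 0" if "ys \<in> X" for ys
    using zero[OF that] unfolding f
    by (simp add: fock_inner_linear gram_of_int fock_inner_commute[of _ "fock_word Legs ys _"])
  have "fock_inner (Legs \<times> {..<N}) f f = (\<Sum>xs\<in>X. d xs * fock_inner (Legs \<times> {..<N}) f (fock_word Legs xs (ground_state Legs r)))"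
    by (subst (2) f) (simp add: fock_inner_linear)
  also have "\<dots> = 0" using orth by (simp add: fock_inner_commute[of _ f])
  finally have "(\<Sum>S\<in>Pow (Legs \<times> {..<N}). f S * f S) = 0" by (simp add: fock_inner_def)
  then have "f S = 0" if "S \<subseteq> Legs \<times> {..<N}" for S
    using that fin by (subst (asm) sum_nonneg_eq_0_iff) auto
  then show ?thesis
    using fock_words_independent[OF fin inj legs bound, of d xs] \<open>xs \<in> X\<close> by (simp add: f_def)
qed

context gl_highest_weight begin

text \<open>
  The hypothesis \<open>wt\<close> says that the weight is that of the ground state on the legs \<open>Legs\<close>. Applying the transpose
  of a word \<open>ys\<close> to the given relation and reading off the coefficient of \<open>v\<close> turns the relation into
  a linear equation whose coefficients are Gram numbers of the Fock space, one equation for each \<open>ys\<close>.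
\<close>

theorem lowering_words_independent:
  fixes Legs :: "'m::countable set" and c :: "(nat \<times> nat) list \<Rightarrow> 'a"
  assumes "v \<noteq> 0" and wt: "wt = (\<lambda>i. of_nat (card {m \<in> Legs. i < r m}))"
    and fin: "finite Legs" "finite X"
    and inj: "inj_on mset X"
    and legs: "\<And>ys. ys \<in> X \<Longrightarrow> \<exists>bs. set bs \<subseteq> Legs \<and> length bs = length ys \<and> admissible r (zip bs ys)"
    and bound: "\<And>m. m \<in> Legs \<Longrightarrow> r m \<le> N" "\<And>ys. ys \<in> X \<Longrightarrow> set ys \<subseteq> {..<N} \<times> {..<N}"
    and zero: "(\<Sum>xs\<in>X. scale (c xs) (e_word xs v)) = 0"
    and "xs \<in> X"
  shows "c xs = 0"
proof -
  let ?\<Omega> = "Legs \<times> {..<N}" and ?g = "ground_state Legs r :: _ \<Rightarrow> 'a"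
  interpret F: gl_highest_weight "\<lambda>c f S. c * f S" N "fock_e Legs" ?g wt
    unfolding wt using fin(1) by (rule fock_highest_weight)
  have F_word: "F.e_word ws f = fock_word Legs ws f" for ws f
    by (induction ws) auto
  have vacuum: "fock_inner ?\<Omega> ?g ?g = 1"
  proof -
    have "ground_config Legs r \<in> Pow ?\<Omega>" using bound(1) by (force simp: ground_config_def)
    moreover have "?g S * ?g S = (if ground_config Legs r = S then 1 else 0)" for S
      by (simp add: ground_state_def)
    ultimately show ?thesis using fin(1) by (simp add: fock_inner_def)
  qed
  \<comment> \<open>The outermost lowering operator is moved to the other side, where it becomes a raising operator.\<close>
  have orth: "fock_inner ?\<Omega> ?g f = 0" if "f \<in> F.lower_part" for f
    using that unfolding F.lower_part_def
  proof (induction rule: F.span_induct_alt)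
    case base
    then show ?case by (simp add: fock_inner_def)
  next
    case (step a w f)
    then obtain ys where ys: "w = F.e_word ys ?g" "set ys \<subseteq> F.lower_pairs" "ys \<noteq> []" by auto
    then obtain i j ys' where y: "ys = (i, j) # ys'" "j < i" "i < N"
      by (cases ys) (auto simp: F.lower_pairs_def)
    have "fock_inner ?\<Omega> ?g w = fock_inner ?\<Omega> (fock_e Legs j i ?g) (F.e_word ys' ?g)"
      using y fin(1) ys by (simp add: fock_inner_e)
    also have "\<dots> = 0" using F.e_raise[of j i] y by (simp add: fock_inner_def)
    finally show ?case
      using step.IH by (simp only: fock_inner_linear mult_zero_right add_0_right)
  qed
  have coefficient: "e_word (transpose_word ys) (e_word xs v) - scale (of_int (gram Legs r N xs ys)) v \<in> lower_part"
    if "xs \<in> X" "ys \<in> X" for xs ys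
  proof -
    have "set (transpose_word ys @ xs) \<subseteq> {..<N} \<times> {..<N}"
      using bound(2)[OF that(1)] bound(2)[OF that(2)] by (auto simp: transpose_word_def)
    then obtain a where a: "e_word (transpose_word ys @ xs) v - scale a v \<in> lower_part"
      and a': "F.e_word (transpose_word ys @ xs) ?g - (\<lambda>S. a * ?g S) \<in> F.lower_part"
      using common_vacuum_coefficient[OF F.gl_highest_weight_axioms] by blast
    have "a = fock_inner ?\<Omega> ?g (F.e_word (transpose_word ys @ xs) ?g)"
      using orth[OF a'] by (simp add: fock_inner_linear vacuum)
    also have "\<dots> = fock_inner ?\<Omega> (fock_word Legs ys ?g) (fock_word Legs xs ?g)"
      using fock_inner_word[OF fin(1) bound(2)[OF that(2)], of ?g "fock_word Legs xs ?g"]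
      by (simp only: F.e_word_append) (simp only: F_word)
    also have "\<dots> = of_int (gram Legs r N xs ys)"
      by (simp add: fock_inner_commute[of _ "fock_word Legs ys _"] gram_of_int)
    finally show ?thesis using a by (simp add: e_word_append)
  qed
  have "(\<Sum>xs\<in>X. c xs * of_int (gram Legs r N xs ys)) = 0" if ys: "ys \<in> X" for ys
  proof -
    have tr: "set (transpose_word ys) \<subseteq> {..<N} \<times> {..<N}"
      using bound(2)[OF ys] by (auto simp: transpose_word_def)
    have "(\<Sum>xs\<in>X. scale (c xs) (e_word (transpose_word ys) (e_word xs v)
          - scale (of_int (gram Legs r N xs ys)) v)) \<in> lower_part"
      using coefficient ys unfolding lower_part_def by (intro span_sum span_scale) auto
    also have "(\<Sum>xs\<in>X. scale (c xs) (e_word (transpose_word ys) (e_word xs v)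
          - scale (of_int (gram Legs r N xs ys)) v))
        = e_word (transpose_word ys) (\<Sum>xs\<in>X. scale (c xs) (e_word xs v))
          - scale (\<Sum>xs\<in>X. c xs * of_int (gram Legs r N xs ys)) v"
      using tr by (simp add: e_word_sum e_word_scale scale_right_diff_distrib sum_subtractf scale_sum_left)
    also have "\<dots> = - scale (\<Sum>xs\<in>X. c xs * of_int (gram Legs r N xs ys)) v"
      using tr by (simp add: zero e_word_zero)
    finally have "scale (\<Sum>xs\<in>X. c xs * of_int (gram Legs r N xs ys)) v \<in> lower_part"
      unfolding lower_part_def using span_neg by fastforce
    then have "v \<in> lower_part" if "(\<Sum>xs\<in>X. c xs * of_int (gram Legs r N xs ys)) \<noteq> 0"
      using that span_scale[of _ _ "inverse (\<Sum>xs\<in>X. c xs * of_int (gram Legs r N xs ys))"]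
      unfolding lower_part_def by fastforce
    then show ?thesis using highest_weight_vector_not_lower[OF \<open>v \<noteq> 0\<close>] by blast
  qed
  moreover have "d xs = 0"
    if "\<And>ys. ys \<in> X \<Longrightarrow> (\<Sum>xs\<in>X. d xs * of_int (gram Legs r N xs ys)) = 0" "xs \<in> X" for d :: "_ \<Rightarrow> rat" and xs
    using gram_nonsingular[OF fin inj legs bound that] by blast
  ultimately show ?thesis
    using int_matrix_nonsingular_transfer[OF fin(2), of "gram Legs r N" c xs] \<open>xs \<in> X\<close> by blast
qed

end

section \<open>Matrices with prescribed support\<close>

definition matrix_unit :: "nat \<Rightarrow> nat \<times> nat \<Rightarrow> 'k::field mat" where
  "matrix_unit N p = mat N N (\<lambda>q. if q = p then 1 else 0)"

definition supported_matrices :: "nat \<Rightarrow> (nat \<times> nat) set \<Rightarrow> 'k::field mat set" where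
  "supported_matrices N R =
     {x \<in> carrier_mat N N. \<forall>i<N. \<forall>j<N. (i, j) \<notin> R \<longrightarrow> x $$ (i, j) = 0}"

lemma matrix_unit_carrier [simp]: "matrix_unit N p \<in> carrier_mat N N"
  and matrix_unit_index [simp]: "i < N \<Longrightarrow> j < N \<Longrightarrow> matrix_unit N p $$ (i, j) = (if (i, j) = p then 1 else 0)"
  by (auto simp: matrix_unit_def)

lemma supported_matrices_vectorspace:
  "vectorspace (class_ring :: 'k::field ring)
     ((module_mat TYPE('k) N N)\<lparr>carrier := supported_matrices N R\<rparr>)"
proof -
  interpret M: vectorspace "class_ring :: 'k ring" "module_mat TYPE('k) N N" by (rule matrix_vs)
  have "submodule (class_ring :: 'k ring) (supported_matrices N R) (module_mat TYPE('k) N N)"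
    by (intro submodule.intro M.module_axioms)
       (auto simp: supported_matrices_def module_mat_simps)
  then have "VectorSpace.subspace (class_ring :: 'k ring) (supported_matrices N R) (module_mat TYPE('k) N N)"
    by (intro VectorSpace.subspace.intro M.vectorspace_axioms)
  then show ?thesis by (rule M.subspace_is_vs)
qed

text \<open>
  The matrix units at the positions in \<open>R\<close> form a basis too, which gives the number of elements. The
  expansion is stated entrywise, as the sum of matrices of a fixed size is not a sum in a
  type class.
\<close>

lemma
  fixes z :: "nat \<Rightarrow> 'k::field mat"
  assumes R: "R \<subseteq> {..<N} \<times> {..<N}" and z: "is_matrix_basis N (supported_matrices N R) d z"
  shows matrix_basis_card: "d = card R"
    and matrix_basis_mem: "t \<in> {1..d} \<Longrightarrow> z t \<in> supported_matrices N R"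
    and matrix_basis_expand: "x \<in> supported_matrices N R \<Longrightarrow>
      \<exists>c. \<forall>i<N. \<forall>j<N. x $$ (i, j) = (\<Sum>t\<in>{1..d}. c t * z t $$ (i, j))"
proof -
  let ?S = "supported_matrices N R :: 'k mat set"
  let ?V = "(module_mat TYPE('k) N N)\<lparr>carrier := ?S\<rparr>"
  interpret V: vectorspace "class_ring :: 'k ring" ?V by (rule supported_matrices_vectorspace)
  have entry: "V.lincomb a A $$ (i, j) = (\<Sum>x\<in>A. a x * x $$ (i, j))"
    if "finite A" "A \<subseteq> ?S" "i < N" "j < N" for a A i j
  proof -
    have "(\<lambda>x. a x \<odot>\<^bsub>?V\<^esub> x) \<in> A \<rightarrow> carrier ?V"
      using that by (auto simp: supported_matrices_def module_mat_simps)
    with \<open>finite A\<close> have "finsum ?V (\<lambda>x. a x \<odot>\<^bsub>?V\<^esub> x) A \<in> carrier_mat N N \<and>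
      finsum ?V (\<lambda>x. a x \<odot>\<^bsub>?V\<^esub> x) A $$ (i, j) = (\<Sum>x\<in>A. a x * x $$ (i, j))"
      using \<open>A \<subseteq> ?S\<close>
    proof (induction A)
      case empty
      then show ?case using that by (simp add: module_mat_simps)
    next
      case (insert y A)
      then have y: "y \<in> carrier_mat N N" by (auto simp: supported_matrices_def)
      have eq: "finsum ?V (\<lambda>x. a x \<odot>\<^bsub>?V\<^esub> x) (insert y A)
          = a y \<cdot>\<^sub>m y + finsum ?V (\<lambda>x. a x \<odot>\<^bsub>?V\<^esub> x) A"
        using insert.hyps insert.prems
        by (subst V.finsum_insert) (auto simp: module_mat_simps)
      have "finsum ?V (\<lambda>x. a x \<odot>\<^bsub>?V\<^esub> x) A \<in> carrier_mat N N"
        "finsum ?V (\<lambda>x. a x \<odot>\<^bsub>?V\<^esub> x) A $$ (i, j) = (\<Sum>x\<in>A. a x * x $$ (i, j))"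
        using insert by auto
      then show ?case
        unfolding eq using insert.hyps that y by auto
    qed
    then show ?thesis by (simp add: V.lincomb_def)
  qed
  have basis: "V.basis (z ` {1..d})" and inj: "inj_on z {1..d}"
    using z by (auto simp: is_matrix_basis_def)
  have zS: "z ` {1..d} \<subseteq> ?S" using basis by (auto simp: V.basis_def)
  then show "z t \<in> ?S" if "t \<in> {1..d}" using that by blast
  show "\<exists>c. \<forall>i<N. \<forall>j<N. x $$ (i, j) = (\<Sum>t\<in>{1..d}. c t * z t $$ (i, j))" if "x \<in> ?S"
  proof -
    have "x \<in> V.span (z ` {1..d})" using basis that by (simp add: V.basis_def)
    then obtain a where x: "x = V.lincomb a (z ` {1..d})"
      using V.finite_span[of "z ` {1..d}"] zS by auto
    have "x $$ (i, j) = (\<Sum>t\<in>{1..d}. a (z t) * z t $$ (i, j))" if "i < N" "j < N" for i j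
      unfolding x using entry[OF _ zS that] inj by (simp add: sum.reindex)
    then show ?thesis by (intro exI[of _ "\<lambda>t. a (z t)"]) auto
  qed
  let ?U = "matrix_unit N ` R :: 'k mat set"
  have finR: "finite R" using R by (rule finite_subset) simp
  have US: "?U \<subseteq> ?S" by (auto simp: supported_matrices_def)
  have injU: "inj_on (matrix_unit N :: _ \<Rightarrow> 'k mat) R"
  proof (rule inj_onI)
    fix p q assume "p \<in> R" "q \<in> R" and eq: "matrix_unit N p = (matrix_unit N q :: 'k mat)"
    then have "fst p < N" "snd p < N" using R by auto
    then show "p = q" using arg_cong[OF eq, of "\<lambda>x. x $$ p"] by (cases p) (auto split: if_splits)
  qed
  have combU: "V.lincomb a (matrix_unit N ` P) $$ (i, j) = (if (i, j) \<in> P then a (matrix_unit N (i, j)) else 0)"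
    if "P \<subseteq> R" "i < N" "j < N" for a P i j
  proof -
    have P: "finite P" "inj_on (matrix_unit N :: _ \<Rightarrow> 'k mat) P" "matrix_unit N ` P \<subseteq> ?S"
      using that finR injU US by (auto intro: finite_subset inj_on_subset)
    have "V.lincomb a (matrix_unit N ` P) $$ (i, j)
        = (\<Sum>p\<in>P. a (matrix_unit N p) * matrix_unit N p $$ (i, j))"
      using entry[of "matrix_unit N ` P" i j a] P that by (simp add: sum.reindex)
    also have "\<dots> = (\<Sum>p\<in>P. if p = (i, j) then a (matrix_unit N p) else 0)"
      using that by (intro sum.cong) auto
    finally show ?thesis using P by simp
  qed
  have "V.basis ?U"
    unfolding V.basis_def
  proof (intro conjI)
    show "V.lin_indpt ?U"
    proof
      assume "V.lin_dep ?U"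
      then obtain A a m where A: "A \<subseteq> ?U" "V.lincomb a A = \<zero>\<^bsub>?V\<^esub>" "m \<in> A" "a m \<noteq> 0"
        by (auto simp: V.lin_dep_def)
      then obtain P where P: "P \<subseteq> R" "A = matrix_unit N ` P" by (meson subset_imageE)
      then obtain p where p: "p \<in> P" "m = matrix_unit N p" using A by auto
      obtain i j where ij: "p = (i, j)" "i < N" "j < N" using p P R by (cases p) auto
      have "V.lincomb a A $$ (i, j) = 0" using A(2) ij by (simp add: module_mat_simps)
      then show False using combU[OF P(1) ij(2,3), of a] P(2) p A(4) ij(1) by simp
    qed
    show "V.gen_set ?U"
    proof
      show "V.span ?U \<subseteq> carrier ?V" using V.span_is_subset2[of ?U] US by simp
      show "carrier ?V \<subseteq> V.span ?U"
      proof
        fix x assume "x \<in> carrier ?V"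
        then have x: "x \<in> ?S" by simp
        define a where "a y = x $$ (the_inv_into R (matrix_unit N) y)" for y :: "'k mat"
        have "V.lincomb a ?U \<in> carrier_mat N N"
          using V.lincomb_closed[of ?U a] US by (auto simp: supported_matrices_def)
        then have "x = V.lincomb a ?U"
          using x combU[OF order_refl, of _ _ a] the_inv_into_f_f[OF injU]
          by (intro eq_matI) (auto simp: supported_matrices_def a_def)
        then show "x \<in> V.span ?U" using V.finite_span[of ?U] finR US by auto
      qed
    qed
    show "?U \<subseteq> carrier ?V" using US by simp
  qed
  then have "card ?U = card (z ` {1..d})"
    using V.dim_basis[of ?U] V.dim_basis[of "z ` {1..d}"] basis finR by simp
  then show "d = card R" using inj injU by (simp add: card_image)
qed

section \<open>Extending the action from trace zero matrices to all matrices\<close>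

definition mtrace :: "nat \<Rightarrow> 'k::comm_ring_1 mat \<Rightarrow> 'k" where
  "mtrace N x = (\<Sum>i<N. x $$ (i, i))"

lemma mtrace_bracket:
  assumes "x \<in> carrier_mat N N" "y \<in> carrier_mat N N"
  shows "mtrace N (lie_bracket x y) = 0"
proof -
  have "mtrace N (lie_bracket x y) = (\<Sum>i<N. \<Sum>j<N. x $$ (i, j) * y $$ (j, i)) - (\<Sum>i<N. \<Sum>j<N. y $$ (i, j) * x $$ (j, i))"
    using assms by (simp add: mtrace_def lie_bracket_def scalar_prod_def sum_subtractf atLeast0LessThan)
  also have "(\<Sum>i<N. \<Sum>j<N. y $$ (i, j) * x $$ (j, i)) = (\<Sum>i<N. \<Sum>j<N. x $$ (i, j) * y $$ (j, i))"
    by (subst sum.swap) (simp add: mult.commute)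
  finally show ?thesis by simp
qed

lemma lie_bracket_carrier [simp]:
  "x \<in> carrier_mat N N \<Longrightarrow> y \<in> carrier_mat N N \<Longrightarrow> lie_bracket x y \<in> carrier_mat N N"
  by (auto simp: lie_bracket_def)

lemma sl_iff: "x \<in> sl N \<longleftrightarrow> x \<in> carrier_mat N N \<and> mtrace N x = 0"
  by (auto simp: sl_def mtrace_def)

lemma mtrace_linear:
  "x \<in> carrier_mat N N \<Longrightarrow> y \<in> carrier_mat N N \<Longrightarrow> mtrace N (x + y) = mtrace N x + mtrace N y"
  "x \<in> carrier_mat N N \<Longrightarrow> y \<in> carrier_mat N N \<Longrightarrow> mtrace N (x - y) = mtrace N x - mtrace N y"
  "x \<in> carrier_mat N N \<Longrightarrow> mtrace N (c \<cdot>\<^sub>m x) = c * mtrace N x"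
  by (simp_all add: mtrace_def sum.distrib sum_subtractf sum_distrib_left)

text \<open>
  The projection onto trace zero matrices along the scalar matrices.
\<close>

definition traceless :: "nat \<Rightarrow> 'k::field mat \<Rightarrow> 'k mat" where
  "traceless N x = x - (mtrace N x / of_nat N) \<cdot>\<^sub>m 1\<^sub>m N"

lemma traceless_sl:
  fixes x :: "'k::field_char_0 mat"
  assumes "x \<in> carrier_mat N N" "0 < N"
  shows "traceless N x \<in> sl N"
proof -
  have "mtrace N (1\<^sub>m N :: 'k mat) = of_nat N" by (simp add: mtrace_def)
  then show ?thesis using assms by (simp add: sl_iff traceless_def mtrace_linear minus_carrier_mat)
qed

lemma traceless_id: "x \<in> sl N \<Longrightarrow> traceless N x = x"
  by (rule eq_matI) (auto simp: sl_iff traceless_def)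

text \<open>
  Scalar matrices are central.
\<close>

lemma lie_bracket_scalar:
  fixes x y :: "'k::field mat"
  assumes "x \<in> carrier_mat N N" "y \<in> carrier_mat N N"
  shows "lie_bracket (x - a \<cdot>\<^sub>m 1\<^sub>m N) (y - b \<cdot>\<^sub>m 1\<^sub>m N) = lie_bracket x y"
proof -
  have left: "lie_bracket (x - a \<cdot>\<^sub>m 1\<^sub>m N) y = lie_bracket x y"
    if "x \<in> carrier_mat N N" "y \<in> carrier_mat N N" for x y :: "'k mat" and a
  proof -
    have "(x - a \<cdot>\<^sub>m 1\<^sub>m N) * y = x * y - a \<cdot>\<^sub>m y" "y * (x - a \<cdot>\<^sub>m 1\<^sub>m N) = y * x - a \<cdot>\<^sub>m y"
      using that by (auto simp: minus_mult_distrib_mat[of _ N N] mult_minus_distrib_mat[of _ N N]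
          mult_smult_assoc_mat[of _ N N] mult_smult_distrib[of _ N N])
    then show ?thesis using that unfolding lie_bracket_def by (intro eq_matI) auto
  qed
  have anti: "lie_bracket u w = - lie_bracket w u"
    if "u \<in> carrier_mat N N" "w \<in> carrier_mat N N" for u w :: "'k mat"
    using that unfolding lie_bracket_def by (intro eq_matI) auto
  have c: "y - b \<cdot>\<^sub>m 1\<^sub>m N \<in> carrier_mat N N" by (intro minus_carrier_mat) simp
  have "lie_bracket (x - a \<cdot>\<^sub>m 1\<^sub>m N) (y - b \<cdot>\<^sub>m 1\<^sub>m N) = lie_bracket x (y - b \<cdot>\<^sub>m 1\<^sub>m N)"
    by (intro left assms c)
  also have "\<dots> = - lie_bracket (y - b \<cdot>\<^sub>m 1\<^sub>m N) x" by (intro anti assms c)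
  also have "\<dots> = - lie_bracket y x" using left[OF assms(2,1)] by simp
  also have "\<dots> = lie_bracket x y" using anti[OF assms] by simp
  finally show ?thesis .
qed

lemma matrix_unit_bracket:
  assumes "i < N" "j < N" "k < N" "l < N"
  shows "lie_bracket (matrix_unit N (i, j)) (matrix_unit N (k, l))
    = (if j = k then matrix_unit N (i, l) else 0\<^sub>m N N) - (if l = i then matrix_unit N (k, j) else 0\<^sub>m N N)"
proof -
  have "matrix_unit N (i, j) * matrix_unit N (k, l) = (if j = k then matrix_unit N (i, l) else 0\<^sub>m N N :: 'a mat)"
    if "i < N" "j < N" "k < N" "l < N" for i j k l
  proof (rule eq_matI)
    fix a b assume "a < dim_row (if j = k then matrix_unit N (i, l) else 0\<^sub>m N N :: 'a mat)"
      "b < dim_col (if j = k then matrix_unit N (i, l) else 0\<^sub>m N N :: 'a mat)"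
    then have ab: "a < N" "b < N" by (auto simp: matrix_unit_def split: if_splits)
    then have "(matrix_unit N (i, j) * matrix_unit N (k, l)) $$ (a, b)
        = (\<Sum>t<N. matrix_unit N (i, j) $$ (a, t) * (matrix_unit N (k, l) $$ (t, b) :: 'a))"
      by (simp add: matrix_unit_def scalar_prod_def atLeast0LessThan)
    also have "\<dots> = (\<Sum>t<N. if t = j then (if a = i \<and> t = k \<and> b = l then 1 else 0) else 0)"
      using ab by (intro sum.cong) auto
    also have "\<dots> = (if a = i \<and> j = k \<and> b = l then 1 else 0)" using that by simp
    finally show "(matrix_unit N (i, j) * matrix_unit N (k, l)) $$ (a, b)
        = (if j = k then matrix_unit N (i, l) else 0\<^sub>m N N :: 'a mat) $$ (a, b)"
      using ab by auto
  qed (auto simp: matrix_unit_def)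
  then show ?thesis using assms by (simp add: lie_bracket_def)
qed

locale sl_module = vector_space scale
  for scale :: "'k::field_char_0 \<Rightarrow> 'v::ab_group_add \<Rightarrow> 'v" +
  fixes N :: nat and \<rho> :: "'k mat \<Rightarrow> 'v \<Rightarrow> 'v"
  assumes sl_lie_module: "lie_module (sl N) scale \<rho>" and N_pos: "0 < N"

sublocale sl_module \<subseteq> matrix_lie_module scale "sl N" \<rho>
  by unfold_locales
     (auto simp: sl_lie_module sl_iff mtrace_linear mtrace_bracket)

context sl_module begin

text \<open>
  The identity matrix acts by the scalar \<open>\<kappa> * N\<close>. A suitable choice of \<open>\<kappa>\<close> makes the weights of the
  diagonal matrix units natural numbers that can be compared with those of the Fock space.
\<close>

definition gl_act :: "'k \<Rightarrow> 'k mat \<Rightarrow> 'v \<Rightarrow> 'v" where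
  "gl_act \<kappa> x u = \<rho> (traceless N x) u + scale (\<kappa> * mtrace N x) u"

lemma gl_act_sl: "x \<in> sl N \<Longrightarrow> gl_act \<kappa> x u = \<rho> x u"
  by (simp add: gl_act_def traceless_id) (simp add: sl_iff)

lemma gl_act_add:
  "x \<in> carrier_mat N N \<Longrightarrow> gl_act \<kappa> x (u + w) = gl_act \<kappa> x u + gl_act \<kappa> x w"
  by (simp add: gl_act_def act_add traceless_sl N_pos scale_right_distrib)

lemma gl_act_scale:
  "x \<in> carrier_mat N N \<Longrightarrow> gl_act \<kappa> x (scale c u) = scale c (gl_act \<kappa> x u)"
  by (simp add: gl_act_def act_scale traceless_sl N_pos scale_right_distrib mult.commute)

lemma gl_act_add_left:
  assumes "x \<in> carrier_mat N N" "y \<in> carrier_mat N N"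
  shows "gl_act \<kappa> (x + y) u = gl_act \<kappa> x u + gl_act \<kappa> y u"
proof -
  have "traceless N (x + y) = traceless N x + traceless N y"
    using assms by (intro eq_matI) (auto simp: traceless_def mtrace_linear add_divide_distrib algebra_simps)
  then show ?thesis
    using assms by (simp add: gl_act_def act_add_left traceless_sl N_pos mtrace_linear
        scale_left_distrib algebra_simps)
qed

lemma gl_act_smult:
  assumes "x \<in> carrier_mat N N"
  shows "gl_act \<kappa> (c \<cdot>\<^sub>m x) u = scale c (gl_act \<kappa> x u)"
proof -
  have "traceless N (c \<cdot>\<^sub>m x) = c \<cdot>\<^sub>m traceless N x"
    using assms by (intro eq_matI) (auto simp: traceless_def mtrace_linear algebra_simps)
  then show ?thesis
    using assms by (simp add: gl_act_def act_smult traceless_sl N_pos mtrace_linear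
        scale_right_distrib mult.left_commute)
qed

lemma gl_act_zero: "gl_act \<kappa> (0\<^sub>m N N) u = 0"
proof -
  have "(0\<^sub>m N N :: 'k mat) = 0 \<cdot>\<^sub>m 0\<^sub>m N N" by auto
  then show ?thesis using gl_act_smult[of "0\<^sub>m N N" \<kappa> 0 u] by simp
qed

lemma gl_act_diff_left:
  assumes "x \<in> carrier_mat N N" "y \<in> carrier_mat N N"
  shows "gl_act \<kappa> (x - y) u = gl_act \<kappa> x u - gl_act \<kappa> y u"
proof -
  have "x - y = x + (-1) \<cdot>\<^sub>m y" using assms by (intro eq_matI) auto
  then show ?thesis using assms by (simp add: gl_act_add_left gl_act_smult)
qed

lemma gl_act_bracket:
  assumes "x \<in> carrier_mat N N" "y \<in> carrier_mat N N"
  shows "gl_act \<kappa> x (gl_act \<kappa> y u) - gl_act \<kappa> y (gl_act \<kappa> x u) = gl_act \<kappa> (lie_bracket x y) u"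
proof -
  have t: "traceless N x \<in> sl N" "traceless N y \<in> sl N" using assms by (simp_all add: traceless_sl N_pos)
  have "lie_bracket x y \<in> sl N" using assms by (simp add: sl_iff mtrace_bracket)
  then have "gl_act \<kappa> (lie_bracket x y) u = \<rho> (lie_bracket x y) u" by (rule gl_act_sl)
  also have "\<dots> = \<rho> (lie_bracket (traceless N x) (traceless N y)) u"
    using assms unfolding traceless_def by (simp add: lie_bracket_scalar)
  also have "\<dots> = \<rho> (traceless N x) (\<rho> (traceless N y) u) - \<rho> (traceless N y) (\<rho> (traceless N x) u)"
    using t by (rule act_bracket)
  also have "\<dots> = gl_act \<kappa> x (gl_act \<kappa> y u) - gl_act \<kappa> y (gl_act \<kappa> x u)"
    using t by (simp add: gl_act_def act_add act_scale scale_right_distrib mult.commute)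
  finally show ?thesis by simp
qed

lemma gl_act_expand:
  assumes "x \<in> carrier_mat N N"
  shows "gl_act \<kappa> x u = (\<Sum>p\<in>{..<N} \<times> {..<N}. scale (x $$ p) (gl_act \<kappa> (matrix_unit N p) u))"
proof -
  define restr where "restr P = mat N N (\<lambda>q. if q \<in> P then x $$ q else 0)" for P
  have "gl_act \<kappa> (restr P) u = (\<Sum>p\<in>P. scale (x $$ p) (gl_act \<kappa> (matrix_unit N p) u))"
    if "finite P" for P
    using that
  proof (induction P)
    case empty
    have "restr {} = 0\<^sub>m N N" by (auto simp: restr_def)
    then show ?case by (simp add: gl_act_zero)
  next
    case (insert p P)
    have "restr (insert p P) = x $$ p \<cdot>\<^sub>m matrix_unit N p + restr P"
      using insert by (intro eq_matI) (auto simp: restr_def matrix_unit_def)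
    moreover have "restr P \<in> carrier_mat N N" by (simp add: restr_def)
    ultimately show ?case
      using insert by (simp add: gl_act_add_left gl_act_smult)
  qed
  moreover have "restr ({..<N} \<times> {..<N}) = x"
    using assms by (intro eq_matI) (auto simp: restr_def)
  ultimately show ?thesis by (metis finite_SigmaI finite_lessThan)
qed

lemma gl_act_gl_module: "gl_module scale N (\<lambda>i j. gl_act \<kappa> (matrix_unit N (i, j)))"
proof (intro gl_module.intro gl_module_axioms.intro vector_space_axioms gl_act_add gl_act_scale
    matrix_unit_carrier)
  fix i j k l u assume "i < N" "j < N" "k < N" "l < N"
  then show "gl_act \<kappa> (matrix_unit N (i, j)) (gl_act \<kappa> (matrix_unit N (k, l)) u)
      - gl_act \<kappa> (matrix_unit N (k, l)) (gl_act \<kappa> (matrix_unit N (i, j)) u)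
    = (if j = k then gl_act \<kappa> (matrix_unit N (i, l)) u else 0)
      - (if l = i then gl_act \<kappa> (matrix_unit N (k, j)) u else 0)"
    by (simp add: gl_act_bracket matrix_unit_bracket gl_act_diff_left gl_act_zero)
qed

end

section \<open>Lowering operators inside a diagonal block\<close>

context gl_highest_weight begin

text \<open>
  With \<open>u m = (e i j)^m v\<close> one has \<open>e j i (u (m + 1)) = - m (m + 1) u m\<close>, as in the representation theory of
  \<open>sl 2\<close> for the highest weight \<open>0\<close>. If \<open>u 1\<close> were nonzero, then \<open>(e j i)^k\<close> would kill \<open>u 1, \<dots>, u k\<close> but
  not \<open>u (k + 1)\<close>, and the vectors \<open>u 1, u 2, \<dots>\<close> would be linearly independent.
\<close>

theorem lowering_kills_equal_weights:
  assumes fin: "finite B" "span B = UNIV" and ij: "j < i" "i < N" and wt: "wt i = wt j"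
  shows "e i j v = 0"
proof (rule ccontr)
  assume nonzero: "e i j v \<noteq> 0"
  have jN: "j < N" using ij by simp
  define u where "u m = (e i j ^^ m) v" for m
  have u_Suc: "u (Suc m) = e i j (u m)" for m by (simp add: u_def)
  have weight: "e j j (u m) - e i i (u m) = scale (- (2 * of_nat m)) (u m)" for m
  proof (induction m)
    case 0
    then show ?case using e_diag[of i] e_diag[of j] ij jN wt by (simp add: u_def)
  next
    case (Suc m)
    have "e j j (u (Suc m)) - e i i (u (Suc m))
        = e i j (e j j (u m) - e i i (u m)) - scale 2 (u (Suc m))"
    proof -
      have "e j j (e i j (u m)) = e i j (e j j (u m)) - e i j (u m)"
        using e_commutator[of j j i j "u m"] ij jN by (simp add: algebra_simps)
      moreover have "e i i (e i j (u m)) = e i j (e i i (u m)) + e i j (u m)"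
        using e_commutator[of i i i j "u m"] ij jN by (simp add: algebra_simps)
      moreover have "e i j (e j j (u m) - e i i (u m)) = e i j (e j j (u m)) - e i j (e i i (u m))"
        using e_add[OF ij(2) jN, of "e j j (u m) - e i i (u m)" "e i i (u m)"] by simp
      moreover have "scale 2 (u (Suc m)) = u (Suc m) + u (Suc m)"
        using scale_left_distrib[of 1 1 "u (Suc m)"] by simp
      ultimately show ?thesis by (simp add: u_Suc)
    qed
    also have "\<dots> = scale (- (2 * of_nat m)) (u (Suc m)) - scale 2 (u (Suc m))"
      by (simp only: Suc.IH e_scale[OF ij(2) jN] u_Suc)
    also have "\<dots> = scale (- (2 * of_nat (Suc m))) (u (Suc m))"
    proof -
      have "- (2 * of_nat m) - 2 = - (2 * of_nat (Suc m) :: 'a)" by simp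
      then show ?thesis by (simp only: scale_left_diff_distrib[symmetric])
    qed
    finally show ?case .
  qed
  have raise: "e j i (u (Suc m)) = scale (- (of_nat m * of_nat (Suc m))) (u m)" for m
  proof (induction m)
    have step: "e j i (u (Suc m)) = e i j (e j i (u m)) + (e j j (u m) - e i i (u m))" for m
      using e_commutator[of j i i j "u m"] ij jN by (simp add: u_Suc algebra_simps)
    case 0
    have "e j i (u 0) = 0" using e_raise[of j i] ij by (simp add: u_def)
    then show ?case using step[of 0] weight[of 0] ij jN by (simp add: e_zero)
    case (Suc m)
    have "e j i (u (Suc (Suc m))) = scale (- (of_nat m * of_nat (Suc m))) (u (Suc m))
        + scale (- (2 * of_nat (Suc m))) (u (Suc m))"
      by (simp only: step[of "Suc m"] Suc.IH weight e_scale[OF ij(2) jN] u_Suc[symmetric])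
    also have "\<dots> = scale (- (of_nat m * of_nat (Suc m)) + - (2 * of_nat (Suc m))) (u (Suc m))"
      by (simp only: scale_left_distrib)
    also have "- (of_nat m * of_nat (Suc m)) + - (2 * of_nat (Suc m)) = - (of_nat (Suc m) * of_nat (Suc (Suc m)) :: 'a)"
      by (simp add: algebra_simps)
    finally show ?case .
  qed
  have lin_add: "(e j i ^^ k) (x + y) = (e j i ^^ k) x + (e j i ^^ k) y"
    and lin_scale: "(e j i ^^ k) (scale c x) = scale c ((e j i ^^ k) x)" for k x y c
    using ij jN by (induction k) (simp_all add: e_add e_scale)
  have kill: "(e j i ^^ k) (u (Suc m)) = 0" if "m < k" for k m
    using that
  proof (induction k arbitrary: m)
    case (Suc k)
    have "(e j i ^^ Suc k) (u (Suc m)) = scale (- (of_nat m * of_nat (Suc m))) ((e j i ^^ k) (u m))"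
      by (simp only: funpow_Suc_right o_apply raise lin_scale)
    also have "\<dots> = 0" using Suc by (cases m) auto
    finally show ?case .
  qed simp
  have keep: "(e j i ^^ k) (u (Suc k)) \<noteq> 0" for k
  proof (induction k)
    case 0
    then show ?case using nonzero by (simp add: u_def)
  next
    case (Suc k)
    have "(e j i ^^ Suc k) (u (Suc (Suc k)))
        = scale (- (of_nat (Suc k) * of_nat (Suc (Suc k)))) ((e j i ^^ k) (u (Suc k)))"
      by (simp only: funpow_Suc_right o_apply raise lin_scale)
    moreover have "- (of_nat (Suc k) * of_nat (Suc (Suc k))) \<noteq> (0 :: 'a)"
      by (simp del: of_nat_Suc)
    ultimately show ?case using Suc by simp
  qed
  have "independent (u ` Suc ` {..<T}) \<and> card (u ` Suc ` {..<T}) = T" for T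
  proof (induction T)
    case 0
    then show ?case by (simp add: independent_empty)
  next
    case (Suc T)
    let ?S = "u ` Suc ` {..<T}"
    have "(e j i ^^ T) x = 0" if "x \<in> span ?S" for x
      using that
    proof (induction rule: span_induct_alt)
      case base
      show ?case using lin_scale[of T 0 0] by simp
    qed (auto simp: lin_add lin_scale kill)
    then have "u (Suc T) \<notin> span ?S" using keep by blast
    moreover from this have "u (Suc T) \<notin> ?S" by (metis span_base)
    moreover have "u ` Suc ` {..<Suc T} = insert (u (Suc T)) ?S" by (simp add: lessThan_Suc)
    ultimately show ?case using Suc by (simp add: independent_insert)
  qed
  from this[of "Suc (card B)"] have "independent (u ` Suc ` {..<Suc (card B)})"
    and "card (u ` Suc ` {..<Suc (card B)}) = Suc (card B)" by auto
  then show False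
    using independent_span_bound[OF fin(1), of "u ` Suc ` {..<Suc (card B)}"] fin(2) by auto
qed

end

section \<open>Counting monomials\<close>

text \<open>
  Adding copies of the extra element \<open>0\<close> fills a multiset of size at most \<open>l\<close> up to size exactly \<open>l\<close>.
\<close>

lemma bounded_multisets:
  shows finite_bounded_multisets: "finite {X. set_mset X \<subseteq> {1..d} \<and> size X \<le> l}"
    and card_bounded_multisets: "card {X. set_mset X \<subseteq> {1..d} \<and> size X \<le> l} = (d + l) choose d"
proof -
  let ?M = "{X. set_mset X \<subseteq> {1..d} \<and> size X \<le> l}"
  have bij: "bij_betw (\<lambda>X. X + replicate_mset (l - size X) 0) ?M (multisets_of_size {0..d} l)"
  proof (rule bij_betwI[where g = "filter_mset (\<lambda>i. i \<noteq> 0)"])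
    show "(\<lambda>X. X + replicate_mset (l - size X) 0) \<in> ?M \<rightarrow> multisets_of_size {0..d} l"
      by (auto simp: multisets_of_size_def split: if_splits)
    show "filter_mset (\<lambda>i. i \<noteq> 0) \<in> multisets_of_size {0..d} l \<rightarrow> ?M"
      by (auto simp: multisets_of_size_def size_filter_mset_lesseq Suc_le_eq)
    fix X assume X: "X \<in> ?M"
    then have "filter_mset (\<lambda>i. i \<noteq> 0) X = X"
      by (intro filter_mset_eq_conv[THEN iffD2] conjI) auto
    then show "filter_mset (\<lambda>i. i \<noteq> 0) (X + replicate_mset (l - size X) 0) = X" by simp
  next
    fix Y assume Y: "Y \<in> multisets_of_size {0..d} l"
    have split: "Y = filter_mset (\<lambda>i. i \<noteq> 0) Y + filter_mset (\<lambda>i. i = 0) Y"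
      using multiset_partition[of Y "\<lambda>i. i \<noteq> 0"] by simp
    have "filter_mset (\<lambda>i. i = 0) Y = replicate_mset (count Y 0) 0"
      by (simp add: filter_eq_replicate_mset)
    moreover have "size Y = size (filter_mset (\<lambda>i. i \<noteq> 0) Y) + count Y 0"
      using arg_cong[OF split, of size] by (simp add: filter_eq_replicate_mset)
    moreover have "size Y = l" using Y by (simp add: multisets_of_size_def)
    ultimately have "l - size (filter_mset (\<lambda>i. i \<noteq> 0) Y) = count Y 0" by linarith
    then show "filter_mset (\<lambda>i. i \<noteq> 0) Y
        + replicate_mset (l - size (filter_mset (\<lambda>i. i \<noteq> 0) Y)) 0 = Y"
      using split by (metis filter_eq_replicate_mset)
  qed
  show "finite ?M"
    using bij_betw_finite[OF bij] finite_multisets_of_size[of "{0..d}" l] by simp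
  have "card ?M = (d + 1 + l - 1) choose l"
    using bij_betw_same_card[OF bij] card_multisets_of_size[of "{0..d}" l] by simp
  also have "\<dots> = (d + l) choose d" using binomial_symmetric[of d "d + l"] by simp
  finally show "card ?M = (d + l) choose d" .
qed

text \<open>
  Independence of a family implies that the family is injective, so the image as a set is as large as
  the index set.
\<close>

lemma (in vector_space) independent_family_image:
  assumes fin: "finite I"
    and indep: "\<And>c. (\<Sum>i\<in>I. scale (c i) (f i)) = 0 \<Longrightarrow> (\<And>i. i \<in> I \<Longrightarrow> c i = 0)"
  shows "inj_on f I" "independent (f ` I)"
proof -
  show inj: "inj_on f I"
  proof (rule inj_onI, rule ccontr)
    fix i j assume ij: "i \<in> I" "j \<in> I" "f i = f j" "i \<noteq> j"
    let ?c = "\<lambda>t. if t = i then 1 else if t = j then - 1 else 0"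
    have "(\<Sum>t\<in>I. scale (?c t) (f t))
        = (\<Sum>t\<in>I. (if t = i then f i else 0) + (if t = j then - f j else 0))"
      using ij(4) by (intro sum.cong) auto
    also have "\<dots> = 0" using fin ij by (simp add: sum.distrib)
    finally show False using indep[of ?c i] ij(1) by simp
  qed
  show "independent (f ` I)"
  proof
    assume "dependent (f ` I)"
    then obtain u i where i: "i \<in> I" "u (f i) \<noteq> 0" and "(\<Sum>x\<in>f ` I. scale (u x) x) = 0"
      using fin by (auto simp: dependent_finite)
    then have "(\<Sum>i\<in>I. scale (u (f i)) (f i)) = 0" using inj by (simp add: sum.reindex)
    then show False using indep[of "\<lambda>i. u (f i)" i] i by simp
  qed
qed

lemma (in vector_space) spanning_set_of_dim_card_independent:
  assumes "finite S" "card S \<le> dim (span S)"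
  shows "independent S" "card S = dim (span S)"
proof -
  obtain B where B: "B \<subseteq> S" "independent B" "span B = span S"
    by (metis maximal_independent_subset span_mono span_minimal subspace_span subset_antisym)
  have "dim (span S) = card B" using B by (metis dim_span_eq_card_independent)
  then have "B = S" using assms B(1) by (metis card_seteq)
  then show "independent S" "card S = dim (span S)" using B \<open>dim (span S) = card B\<close> by auto
qed

context matrix_lie_module begin

lemma monomial_act_eq_ordered_monomial:
  "monomial_act \<rho> d z a v = ordered_monomial z v (\<Sum>i\<in>{1..d}. replicate_mset (a i) i)"
proof -
  have "foldr (\<lambda>i u. (\<rho> (z i) ^^ a i) u) is v
      = act_word (map z (concat (map (\<lambda>i. replicate (a i) i) is))) v" for "is"
    by (induction "is") auto
  moreover have "sorted_list_of_multiset (\<Sum>i\<in>{1..d}. replicate_mset (a i) i)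
      = concat (map (\<lambda>i. replicate (a i) i) [1..<d + 1])"
  proof -
    let ?l = "\<lambda>m. concat (map (\<lambda>i. replicate (a i) i) [1..<m + 1])"
    have "sorted (?l m) \<and> mset (?l m) = (\<Sum>i\<in>{1..m}. replicate_mset (a i) i)" for m
      by (induction m) (auto simp: sorted_append sorted_replicate)
    then show ?thesis by (metis sorted_list_of_multiset_mset sorted_sort_id)
  qed
  ultimately show ?thesis by (simp add: monomial_act_def ordered_monomial_def)
qed

lemma monomials_eq_ordered_monomials:
  "{monomial_act \<rho> d z a v | a. (\<Sum>i=1..d. a i) \<le> l}
     = ordered_monomial z v ` {X. set_mset X \<subseteq> {1..d} \<and> size X \<le> l}"
proof (intro subset_antisym subsetI)
  fix w assume "w \<in> {monomial_act \<rho> d z a v | a. (\<Sum>i=1..d. a i) \<le> l}"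
  then obtain a where a: "w = monomial_act \<rho> d z a v" "(\<Sum>i=1..d. a i) \<le> l" by auto
  let ?X = "\<Sum>i\<in>{1..d}. replicate_mset (a i) i"
  have "size ?X = (\<Sum>i=1..d. a i)" by (simp add: size_multiset_sum)
  moreover have "set_mset ?X \<subseteq> {1..d}" by (auto simp: set_mset_sum split: if_splits)
  ultimately show "w \<in> ordered_monomial z v ` {X. set_mset X \<subseteq> {1..d} \<and> size X \<le> l}"
    using a by (auto simp: monomial_act_eq_ordered_monomial)
next
  fix w assume "w \<in> ordered_monomial z v ` {X. set_mset X \<subseteq> {1..d} \<and> size X \<le> l}"
  then obtain X where X: "w = ordered_monomial z v X" "set_mset X \<subseteq> {1..d}" "size X \<le> l" by auto
  have eq: "(\<Sum>i\<in>{1..d}. replicate_mset (count X i) i) = X"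
  proof (rule multiset_eqI)
    fix i
    have "count (\<Sum>i\<in>{1..d}. replicate_mset (count X i) i) i = (\<Sum>j\<in>{1..d}. if j = i then count X i else 0)"
      by (simp add: count_sum)
    also have "\<dots> = count X i" using X(2) by (auto simp: count_eq_zero_iff)
    finally show "count (\<Sum>i\<in>{1..d}. replicate_mset (count X i) i) i = count X i" .
  qed
  moreover have "(\<Sum>i=1..d. count X i) \<le> l"
    using X(3) arg_cong[OF eq, of size] by (simp add: size_multiset_sum)
  ultimately show "w \<in> {monomial_act \<rho> d z a v | a. (\<Sum>i=1..d. a i) \<le> l}"
    using X(1) by (auto simp: monomial_act_eq_ordered_monomial intro!: exI[of _ "count X"])
qed

end

section \<open>Flags\<close>

locale flag =
  fixes N k :: nat and n :: "nat \<Rightarrow> nat"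
  assumes k_pos: "1 \<le> k" and n_first: "1 \<le> n 1" and n_step: "\<forall>i\<in>{1..<k}. n i < n (i + 1)"
    and n_last: "n k \<le> N - 1" and n_0: "n 0 = 0" and n_top: "n (k + 1) = N"
begin

definition block :: "nat \<Rightarrow> nat set" where
  "block s = {n (s - 1)..<n s}"

text \<open>
  The positions strictly below the diagonal blocks, described by the steps of the flag that separate
  the column index from the row index. It is this description that the legs are matched with.
\<close>

definition separated_pairs :: "(nat \<times> nat) set" where
  "separated_pairs = {(i, j). i < N \<and> (\<exists>s\<in>{1..k}. j < n s \<and> n s \<le> i)}"

lemma n_Suc: "s \<le> k \<Longrightarrow> n s < n (Suc s)"
proof -
  assume s: "s \<le> k"
  have "1 \<le> n m" if "1 \<le> m" "m \<le> k" for m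
    using that(1) that(2)
  proof (induction m rule: dec_induct)
    case (step m)
    then show ?case using n_step[rule_format, of m] by auto
  qed (use n_first in simp)
  then have "n k < N" using n_last k_pos by fastforce
  consider "s = 0" | "s = k" | "s \<in> {1..<k}" using s by force
  then show ?thesis
  proof cases
    case 1 then show ?thesis using n_0 n_first by simp
  next
    case 2 then show ?thesis using \<open>n k < N\<close> n_top by simp
  next
    case 3 then show ?thesis using n_step by auto
  qed
qed

lemma n_mono: "s \<le> t \<Longrightarrow> t \<le> k + 1 \<Longrightarrow> n s \<le> n t"
proof (induction t rule: dec_induct)
  case (step t)
  then show ?case using n_Suc[of t] by simp
qed simp

lemma n_bound: "s \<le> k + 1 \<Longrightarrow> n s \<le> N"
  using n_mono[of s "k + 1"] n_top by simp

lemma N_positive: "0 < N"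
  using n_Suc[of 0] n_bound[of 1] n_0 by simp

lemma block_exists:
  assumes "i < N"
  obtains s where "s \<in> {1..k + 1}" "i \<in> block s"
proof -
  define s where "s = (LEAST s. i < n s)"
  have ex: "i < n (k + 1)" using assms n_top by simp
  have s: "i < n s" unfolding s_def using ex by (rule LeastI)
  have "s \<le> k + 1" unfolding s_def using ex by (rule Least_le)
  moreover have "s \<noteq> 0" using s n_0 by (cases s) auto
  moreover have "n (s - 1) \<le> i"
    using not_less_Least[of "s - 1" "\<lambda>s. i < n s"] \<open>s \<noteq> 0\<close> by (simp add: s_def[symmetric])
  ultimately show ?thesis using that[of s] s by (auto simp: block_def)
qed

lemma separated_iff_block_less:
  assumes "s \<in> {1..k + 1}" "t \<in> {1..k + 1}" "i \<in> block s" "j \<in> block t"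
  shows "(i, j) \<in> separated_pairs \<longleftrightarrow> t < s"
proof
  assume "(i, j) \<in> separated_pairs"
  then obtain q where q: "q \<in> {1..k}" "j < n q" "n q \<le> i" by (auto simp: separated_pairs_def)
  have "q < s"
  proof (rule ccontr)
    assume "\<not> q < s"
    then have "n s \<le> n q" using q by (intro n_mono) auto
    then show False using q assms by (auto simp: block_def)
  qed
  moreover have "t - 1 < q"
  proof (rule ccontr)
    assume "\<not> t - 1 < q"
    then have "n q \<le> n (t - 1)" using assms by (intro n_mono) auto
    then show False using q assms by (auto simp: block_def)
  qed
  ultimately show "t < s" by simp
next
  assume "t < s"
  then have "n t \<le> n (s - 1)" using assms by (intro n_mono) auto
  then have "j < n t" "n t \<le> i" "t \<in> {1..k}" using assms \<open>t < s\<close> by (auto simp: block_def)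
  moreover have "i < N" using assms(1,3) n_bound[of s] by (auto simp: block_def)
  ultimately show "(i, j) \<in> separated_pairs" by (auto simp: separated_pairs_def)
qed

lemma separated_pairs_subset: "separated_pairs \<subseteq> {..<N} \<times> {..<N}"
  by (auto simp: separated_pairs_def)

lemma separated_pairs_lower: "(i, j) \<in> separated_pairs \<Longrightarrow> j < i"
  by (auto simp: separated_pairs_def)

lemma opposite_radical_eq: "opposite_radical N k n = supported_matrices N separated_pairs"
proof (intro subset_antisym subsetI)
  fix x :: "'a mat" assume x: "x \<in> opposite_radical N k n"
  have "x $$ (i, j) = 0" if "i < N" "j < N" "(i, j) \<notin> separated_pairs" for i j
  proof -
    obtain s t where st: "s \<in> {1..k + 1}" "i \<in> block s" "t \<in> {1..k + 1}" "j \<in> block t"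
      using block_exists \<open>i < N\<close> \<open>j < N\<close> by metis
    then have "s \<le> t" using separated_iff_block_less that(3) by (metis not_le)
    then show ?thesis using x st unfolding opposite_radical_def block_def by blast
  qed
  then show "x \<in> supported_matrices N separated_pairs"
    using x by (auto simp: supported_matrices_def opposite_radical_def)
next
  fix x :: "'a mat" assume x: "x \<in> supported_matrices N separated_pairs"
  have "x $$ (i, j) = 0"
    if st: "s \<in> {1..k + 1}" "t \<in> {1..k + 1}" "s \<le> t" "i \<in> block s" "j \<in> block t" for s t i j
  proof -
    have "i < N" "j < N" using st n_bound[of s] n_bound[of t] by (auto simp: block_def)
    moreover have "(i, j) \<notin> separated_pairs" using separated_iff_block_less[OF st(1,2,4,5)] st(3) by simp
    ultimately show ?thesis using x by (auto simp: supported_matrices_def)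
  qed
  then show "x \<in> opposite_radical N k n"
    using x unfolding opposite_radical_def supported_matrices_def block_def by blast
qed

lemma card_separated_pairs:
  "card separated_pairs = (\<Sum>s=1..k+1. \<Sum>t=1..<s. (n s - n (s - 1)) * (n t - n (t - 1)))"
proof -
  let ?I = "SIGMA s:{1..k+1}. {1..<s}"
  have "separated_pairs = (\<Union>(s, t)\<in>?I. block s \<times> block t)"
  proof (intro subset_antisym subsetI)
    fix p assume p: "p \<in> separated_pairs"
    obtain i j where ij: "p = (i, j)" "i < N" "j < N" using p separated_pairs_subset by (cases p) auto
    obtain s t where st: "s \<in> {1..k + 1}" "i \<in> block s" "t \<in> {1..k + 1}" "j \<in> block t"
      using block_exists ij by metis
    then have "t < s" using separated_iff_block_less p ij by metis
    then show "p \<in> (\<Union>(s, t)\<in>?I. block s \<times> block t)"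
      using st ij by (intro UN_I[of "(s, t)"]) auto
  next
    fix p assume "p \<in> (\<Union>(s, t)\<in>?I. block s \<times> block t)"
    then obtain s t where "s \<in> {1..k + 1}" "t \<in> {1..<s}" "fst p \<in> block s" "snd p \<in> block t" by auto
    then show "p \<in> separated_pairs"
      using separated_iff_block_less[of s t "fst p" "snd p"] by auto
  qed
  also have "card \<dots> = (\<Sum>q\<in>?I. card (case q of (s, t) \<Rightarrow> block s \<times> block t))"
  proof (rule card_UN_disjoint)
    have disj: "s = s'" if "s \<in> {1..k + 1}" "s' \<in> {1..k + 1}" "i \<in> block s" "i \<in> block s'" for s s' i
      using separated_iff_block_less[of s s' i i] separated_iff_block_less[of s' s i i]
        separated_pairs_lower[of i i] that by (metis less_irrefl linorder_neqE_nat)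
    show "\<forall>q\<in>?I. \<forall>q'\<in>?I. q \<noteq> q' \<longrightarrow>
        (case q of (s, t) \<Rightarrow> block s \<times> block t) \<inter> (case q' of (s, t) \<Rightarrow> block s \<times> block t) = {}"
    proof (intro ballI impI)
      fix q q' assume q: "q \<in> ?I" "q' \<in> ?I" "q \<noteq> q'"
      obtain s t s' t' where st: "q = (s, t)" "q' = (s', t')" by (cases q; cases q')
      have False if "(i, j) \<in> block s \<times> block t" "(i, j) \<in> block s' \<times> block t'" for i j
        using disj[of s s' i] disj[of t t' j] that q st by auto
      then show "(case q of (s, t) \<Rightarrow> block s \<times> block t) \<inter> (case q' of (s, t) \<Rightarrow> block s \<times> block t) = {}"
        using st by auto
    qed
  qed (auto simp: block_def)
  also have "\<dots> = (\<Sum>s=1..k+1. \<Sum>t=1..<s. (n s - n (s - 1)) * (n t - n (t - 1)))"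
    by (simp add: sum.Sigma split_beta card_cartesian_product block_def del: sum.cl_ivl_Suc)
  finally show ?thesis .
qed

text \<open>
  The coefficient \<open>ls s\<close> of the fundamental weight number \<open>n s\<close> becomes \<open>ls s\<close> legs of type \<open>s\<close>, on which
  \<open>n s\<close> modes are occupied.
\<close>

definition leg_set :: "(nat \<Rightarrow> nat) \<Rightarrow> (nat \<times> nat) set" where
  "leg_set ls = (SIGMA s:{1..k}. {..<ls s})"

text \<open>
  The \<open>q\<close>-th letter acts on the \<open>q\<close>-th leg of a type that separates its two indices. This leg exists
  because the length of the word is at most the number of legs of each type.
\<close>

lemma admissible_legs:
  assumes "set ys \<subseteq> separated_pairs" "length ys \<le> l" "\<forall>s\<in>{1..k}. l \<le> ls s"
  shows "\<exists>bs. set bs \<subseteq> leg_set ls \<and> length bs = length ys \<and> admissible (n \<circ> fst) (zip bs ys)"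
proof -
  \<comment> \<open>A type of legs whose step separates the two indices of \<open>p\<close>.\<close>
  define sep where "sep p = (SOME s. s \<in> {1..k} \<and> snd p < n s \<and> n s \<le> fst p)" for p
  have sep: "sep p \<in> {1..k} \<and> snd p < n (sep p) \<and> n (sep p) \<le> fst p" if "p \<in> separated_pairs" for p
  proof -
    have "\<exists>s. s \<in> {1..k} \<and> snd p < n s \<and> n s \<le> fst p"
      using that by (cases p) (auto simp: separated_pairs_def)
    then show ?thesis unfolding sep_def by (rule someI_ex)
  qed
  define bs where "bs = map (\<lambda>q. (sep (ys ! q), q)) [0..<length ys]"
  have mem: "ys ! q \<in> separated_pairs" if "q < length ys" for q using assms(1) that by auto
  have "set bs \<subseteq> leg_set ls"
  proof
    fix b assume "b \<in> set bs"
    then obtain q where q: "q < length ys" "b = (sep (ys ! q), q)" by (auto simp: bs_def)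
    have "q < l" using q assms(2) by simp
    then have "q < ls (sep (ys ! q))" using sep[OF mem[OF q(1)]] assms(3) by fastforce
    then show "b \<in> leg_set ls" using sep[OF mem[OF q(1)]] q by (simp add: leg_set_def)
  qed
  moreover have "length bs = length ys" by (simp add: bs_def)
  moreover have "admissible (n \<circ> fst) (zip bs ys)"
  proof -
    have "distinct bs" by (auto simp: bs_def distinct_map inj_on_def)
    moreover have "j < n (fst m) \<and> n (fst m) \<le> i" if mz: "(m, i, j) \<in> set (zip bs ys)" for m i j
    proof -
      obtain q where q: "q < length ys" "m = bs ! q" "(i, j) = ys ! q"
        using mz by (auto simp: set_zip bs_def)
      then have "fst m = sep (i, j)" by (simp add: bs_def)
      then show ?thesis using sep[OF mem[OF q(1)]] q(3)[symmetric] by simp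
    qed
    ultimately show ?thesis using \<open>length bs = length ys\<close> by (auto simp: admissible_def)
  qed
  ultimately show ?thesis by blast
qed

end

section \<open>The canonical filtration of the highest weight module\<close>

lemma supported_matrices_sl:
  assumes "\<And>i. (i, i) \<notin> R" "x \<in> supported_matrices N R"
  shows "x \<in> sl N"
  using assms by (auto simp: sl_def supported_matrices_def)

text \<open>
  The splitting required by \<open>filtration_eq_span_ordered_monomials\<close>: the entries at the positions in
  \<open>R\<close> are expanded in the \<open>z t\<close>, and the remaining entries belong to matrix units that stabilise the
  line of \<open>v\<close>.
\<close>

lemma (in sl_module) stabilizer_complement:
  assumes R: "R \<subseteq> {..<N} \<times> {..<N}" "\<And>i. (i, i) \<notin> R"
    and stab: "\<And>i j. i < N \<Longrightarrow> j < N \<Longrightarrow> (i, j) \<notin> R \<Longrightarrow> \<exists>a. gl_act \<kappa> (matrix_unit N (i, j)) v = scale a v"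
    and z: "\<And>t. t \<in> I \<Longrightarrow> z t \<in> supported_matrices N R"
    and expand: "\<And>x. x \<in> supported_matrices N R \<Longrightarrow>
      \<exists>c. \<forall>i<N. \<forall>j<N. x $$ (i, j) = (\<Sum>t\<in>I. c t * z t $$ (i, j))"
    and x: "x \<in> sl N"
  shows "\<exists>y\<in>sl N. \<exists>a c. \<rho> y v = scale a v \<and>
    (\<forall>u. \<rho> x u = \<rho> y u + (\<Sum>t\<in>I. scale (c t) (\<rho> (z t) u)))"
proof -
  let ?P = "{..<N} \<times> {..<N}"
  define w where "w = mat N N (\<lambda>p. if p \<in> R then x $$ p else 0)"
  define y where "y = mat N N (\<lambda>p. if p \<in> R then 0 else x $$ p)"
  have carrier: "x \<in> carrier_mat N N" "w \<in> carrier_mat N N" "y \<in> carrier_mat N N"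
    using x by (auto simp: sl_iff w_def y_def)
  have wS: "w \<in> supported_matrices N R" by (auto simp: supported_matrices_def w_def)
  have w_sl: "w \<in> sl N" using R(2) wS by (rule supported_matrices_sl)
  have x_eq: "x = y + w" using carrier by (intro eq_matI) (auto simp: w_def y_def)
  have "mtrace N y = 0"
    using x w_sl carrier mtrace_linear(1)[of y N w] by (simp add: sl_iff x_eq)
  then have y_sl: "y \<in> sl N" using carrier by (simp add: sl_iff)
  obtain c where c: "\<And>i j. i < N \<Longrightarrow> j < N \<Longrightarrow> w $$ (i, j) = (\<Sum>t\<in>I. c t * z t $$ (i, j))"
    using expand[OF wS] by blast
  have "\<rho> x u = \<rho> y u + (\<Sum>t\<in>I. scale (c t) (\<rho> (z t) u))" for u
  proof -
    have "\<rho> w u = (\<Sum>p\<in>?P. scale (w $$ p) (gl_act \<kappa> (matrix_unit N p) u))"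
      using gl_act_expand[OF carrier(2), of \<kappa> u] gl_act_sl[OF w_sl] by simp
    also have "\<dots> = (\<Sum>p\<in>?P. \<Sum>t\<in>I. scale (c t) (scale (z t $$ p) (gl_act \<kappa> (matrix_unit N p) u)))"
      by (intro sum.cong refl) (auto simp: c scale_sum_left)
    also have "\<dots> = (\<Sum>t\<in>I. scale (c t) (\<Sum>p\<in>?P. scale (z t $$ p) (gl_act \<kappa> (matrix_unit N p) u)))"
      by (subst sum.swap) (simp only: scale_sum_right)
    also have "\<dots> = (\<Sum>t\<in>I. scale (c t) (\<rho> (z t) u))"
    proof (intro sum.cong refl)
      fix t assume "t \<in> I"
      then have "z t \<in> sl N" using z R(2) supported_matrices_sl by blast
      then show "scale (c t) (\<Sum>p\<in>?P. scale (z t $$ p) (gl_act \<kappa> (matrix_unit N p) u)) = scale (c t) (\<rho> (z t) u)"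
        using gl_act_expand[of "z t" \<kappa> u] gl_act_sl[of "z t" \<kappa> u] by (simp add: sl_iff)
    qed
    finally show ?thesis using y_sl w_sl by (simp add: x_eq act_add_left)
  qed
  moreover have "\<exists>a. \<rho> y v = scale a v"
  proof -
    obtain a where a: "\<And>i j. i < N \<Longrightarrow> j < N \<Longrightarrow> (i, j) \<notin> R \<Longrightarrow> gl_act \<kappa> (matrix_unit N (i, j)) v = scale (a (i, j)) v"
      using stab by (metis case_prod_conv)
    have "\<rho> y v = (\<Sum>p\<in>?P. scale (y $$ p) (gl_act \<kappa> (matrix_unit N p) v))"
      using gl_act_expand[OF carrier(3), of \<kappa> v] gl_act_sl[OF y_sl] by simp
    also have "\<dots> = (\<Sum>p\<in>?P. scale (y $$ p * a p) v)"
    proof (intro sum.cong refl)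
      fix p assume "p \<in> ?P"
      then show "scale (y $$ p) (gl_act \<kappa> (matrix_unit N p) v) = scale (y $$ p * a p) v"
        by (cases p; cases "p \<in> R") (auto simp: y_def a)
    qed
    also have "\<dots> = scale (\<Sum>p\<in>?P. y $$ p * a p) v" by (simp add: scale_sum_left)
    finally show ?thesis by blast
  qed
  ultimately show ?thesis using y_sl by blast
qed

text \<open>
  The projection to trace zero shifts the weight of every diagonal matrix unit by the same amount, the
  average of the weights. Restoring it gives the number of legs on which the mode \<open>i\<close> is occupied.
\<close>

lemma weight_of_traceless_unit:
  fixes lam :: "'k::field_char_0 mat \<Rightarrow> 'k" and k i N :: nat
  assumes lam: "\<forall>h. lam h = (\<Sum>s=1..k. of_nat (ls s) * fund_weight (n s) h)"
    and i: "i < N" and bound: "\<And>s. s \<in> {1..k} \<Longrightarrow> n s \<le> N"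
  shows "lam (traceless N (matrix_unit N (i, i))) + (\<Sum>s=1..k. of_nat (ls s) * of_nat (n s)) / of_nat N
    = of_nat (card {m \<in> SIGMA s:{1..k}. {..<ls s}. i < n (fst m)})"
proof -
  let ?h = "traceless N (matrix_unit N (i, i)) :: 'k mat"
  have tr: "mtrace N (matrix_unit N (i, i)) = (1 :: 'k)" using i by (simp add: mtrace_def)
  have entry: "?h $$ (j, j) = (if j = i then 1 else 0) - 1 / of_nat N" if "j < N" for j
    using that by (auto simp: traceless_def tr)
  have "fund_weight (n s) ?h = (if i < n s then 1 else 0) - of_nat (n s) / of_nat N"
    if "s \<in> {1..k}" for s
  proof -
    have "fund_weight (n s) ?h = (\<Sum>j<n s. ?h $$ (j, j))"
      unfolding fund_weight_def diag_entry_def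
      by (rule sum.reindex_bij_witness[where i = Suc and j = "\<lambda>j. j - 1"]) auto
    also have "\<dots> = (\<Sum>j<n s. (if j = i then 1 else 0) - 1 / of_nat N)"
      using bound[OF that] by (intro sum.cong refl entry) simp
    also have "\<dots> = (if i < n s then 1 else 0) - of_nat (n s) / of_nat N"
      by (simp add: sum_subtractf)
    finally show ?thesis .
  qed
  then have "lam ?h = (\<Sum>s=1..k. of_nat (ls s) * ((if i < n s then 1 else 0) - of_nat (n s) / of_nat N))"
    unfolding lam[rule_format] by (intro sum.cong) simp_all
  also have "\<dots> = (\<Sum>s=1..k. if i < n s then of_nat (ls s) else 0)
      - (\<Sum>s=1..k. of_nat (ls s) * of_nat (n s)) / of_nat N"
    unfolding sum_divide_distrib sum_subtractf[symmetric]
    by (intro sum.cong refl) (auto simp: right_diff_distrib)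
  finally have "lam ?h + (\<Sum>s=1..k. of_nat (ls s) * of_nat (n s)) / of_nat N
      = (\<Sum>s=1..k. if i < n s then of_nat (ls s) else 0)" by simp
  moreover have "card {m \<in> SIGMA s:{1..k}. {..<ls s}. i < n (fst m)} = (\<Sum>s=1..k. if i < n s then ls s else 0)"
  proof -
    have "{m \<in> SIGMA s:{1..k}. {..<ls s}. i < n (fst m)} = (SIGMA s:{1..k}. if i < n s then {..<ls s} else {})"
      by (auto split: if_splits)
    then have "card {m \<in> SIGMA s:{1..k}. {..<ls s}. i < n (fst m)}
        = card (SIGMA s:{1..k}. if i < n s then {..<ls s} else {})" by simp
    also have "\<dots> = (\<Sum>s=1..k. card (if i < n s then {..<ls s} else {}))"
      by (rule card_SigmaI) auto
    also have "\<dots> = (\<Sum>s=1..k. if i < n s then ls s else 0)" by (intro sum.cong) auto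
    finally show ?thesis .
  qed
  moreover have "of_nat (\<Sum>s=1..k. if i < n s then ls s else 0) = (\<Sum>s=1..k. if i < n s then of_nat (ls s) else 0 :: 'k)"
    by (simp add: if_distrib cong: if_cong)
  ultimately show ?thesis by simp
qed

theorem theorem3p10:
  fixes N k l d :: nat
    and n ls b :: "nat \<Rightarrow> nat"
    and scale :: "'k::{alg_closed_field, field_char_0} \<Rightarrow> 'v::ab_group_add \<Rightarrow> 'v"
    and \<rho> :: "'k mat \<Rightarrow> 'v \<Rightarrow> 'v"
    and v :: 'v
    and lam :: "'k mat \<Rightarrow> 'k"
    and z :: "nat \<Rightarrow> 'k mat"
    and D :: nat
  assumes "1 \<le> k"
    and "1 \<le> n 1" and "\<forall>i\<in>{1..<k}. n i < n (i + 1)" and "n k \<le> N - 1"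
    and "n 0 = 0" and "n (k + 1) = N"
    and "\<forall>i\<in>{1..k}. 1 \<le> ls i"
    and "\<forall>h. lam h = (\<Sum>i=1..k. of_nat (ls i) * fund_weight (n i) h)"
    and "irreducible_module (sl N) scale \<rho>" and "finite_dim scale"
    and "highest_weight_vector N scale \<rho> lam v"
    and "is_matrix_basis N (opposite_radical N k n) d z"
    and "1 \<le> l" and "l \<le> Min (ls ` {1..k})"
    and "\<forall>i\<in>{1..k+1}. b i = n i - n (i - 1)"
    and "D = (\<Sum>i=1..k+1. \<Sum>j=1..<i. b i * b j)"
  shows "(let L = canonical_filtration (sl N) scale \<rho> v l;
              B = {monomial_act \<rho> d z a v | a. (\<Sum>i=1..d. a i) \<le> l}
          in \<not> Modules.module.dependent scale B \<and> Modules.module.span scale B = L)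
       \<and> vector_space.dim scale (canonical_filtration (sl N) scale \<rho> v l) = (D + l) choose D"
proof -
  interpret flag N k n by unfold_locales (fact assms)+
  have lie: "lie_module (sl N) scale \<rho>" using assms(9) by (simp add: irreducible_module_def)
  then interpret vector_space scale by (simp add: lie_module_def)
  interpret sl_module scale N \<rho> by unfold_locales (fact lie N_positive)+
  have v: "v \<noteq> 0" "\<And>h. h \<in> cartan N \<Longrightarrow> \<rho> h v = scale (lam h) v"
    "\<And>x. x \<in> strictly_upper N \<Longrightarrow> \<rho> x v = 0"
    using assms(11) by (auto simp: highest_weight_vector_def)
  let ?R = separated_pairs and ?Legs = "leg_set ls" and ?r = "n \<circ> fst"
  \<comment> \<open>The scalar by which a diagonal matrix unit has to be corrected: the average of the weights.\<close>
  define \<kappa> :: 'k where "\<kappa> = (\<Sum>s=1..k. of_nat (ls s) * of_nat (n s)) / of_nat N"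
  let ?e = "\<lambda>i j. gl_act \<kappa> (matrix_unit N (i, j))"
  let ?wt = "\<lambda>i. of_nat (card {m \<in> ?Legs. i < ?r m}) :: 'k"
  interpret G: gl_highest_weight scale N ?e v ?wt
  proof (intro gl_highest_weight.intro gl_act_gl_module gl_highest_weight_axioms.intro)
    fix i j assume ij: "i < j" "j < N"
    then have "matrix_unit N (i, j) \<in> (sl N :: 'k mat set)"
      "matrix_unit N (i, j) \<in> (strictly_upper N :: 'k mat set)"
      by (auto simp: sl_def strictly_upper_def)
    then show "?e i j v = 0" using v(3) by (simp add: gl_act_sl)
  next
    fix i assume i: "i < N"
    let ?h = "traceless N (matrix_unit N (i, i)) :: 'k mat"
    have "?h \<in> cartan N"
      using traceless_sl[OF matrix_unit_carrier N_positive, of "(i, i)"]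
      by (auto simp: cartan_def diagonal_mat_def traceless_def matrix_unit_def)
    then have "?e i i v = scale (lam ?h) v + scale (\<kappa> * mtrace N (matrix_unit N (i, i))) v"
      by (simp add: gl_act_def v(2))
    also have "mtrace N (matrix_unit N (i, i)) = (1 :: 'k)" using i by (simp add: mtrace_def)
    also have "scale (lam ?h) v + scale (\<kappa> * 1) v = scale (lam ?h + \<kappa>) v"
      by (simp add: scale_left_distrib)
    also have "lam ?h + \<kappa> = ?wt i"
      unfolding \<kappa>_def leg_set_def comp_def
      using assms(8) i n_bound by (intro weight_of_traceless_unit) auto
    finally show "?e i i v = scale (?wt i) v" .
  qed
  obtain F where F: "finite F" "span F = UNIV" using assms(10) by (auto simp: finite_dim_def)
  have stab: "\<exists>a. ?e i j v = scale a v" if "i < N" "j < N" "(i, j) \<notin> ?R" for i j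
  proof (cases i j rule: linorder_cases)
    case less
    then have "?e i j v = scale 0 v" using G.e_raise that by simp
    then show ?thesis by blast
  next
    case equal
    then show ?thesis using G.e_diag that by blast
  next
    case greater
    have "i < n s \<longleftrightarrow> j < n s" if "s \<in> {1..k}" for s
      using \<open>(i, j) \<notin> ?R\<close> \<open>i < N\<close> greater that unfolding separated_pairs_def by fastforce
    then have "{m \<in> ?Legs. i < ?r m} = {m \<in> ?Legs. j < ?r m}" by (auto simp: leg_set_def)
    then have "?e i j v = scale 0 v"
      using G.lowering_kills_equal_weights[OF F greater \<open>i < N\<close>] by simp
    then show ?thesis by blast
  qed
  have diag: "(i, i) \<notin> ?R" for i using separated_pairs_lower by blast
  have z: "is_matrix_basis N (supported_matrices N ?R) d z"
    using assms(12) by (simp add: opposite_radical_eq)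
  have D: "D = card ?R"
    unfolding assms(16) card_separated_pairs
    by (intro sum.cong refl arg_cong2[where f = "(*)"]) (use assms(15) in auto)
  then have d: "d = D" using matrix_basis_card[OF separated_pairs_subset z] by simp
  define M where "M = {X. set_mset X \<subseteq> {1..d} \<and> size X \<le> l}"
  have finM: "finite M" unfolding M_def by (rule finite_bounded_multisets)
  have split: "\<exists>y\<in>sl N. \<exists>a c. \<rho> y v = scale a v \<and>
      (\<forall>u. \<rho> x u = \<rho> y u + (\<Sum>t\<in>{1..d}. scale (c t) (\<rho> (w t) u)))"
    if "\<And>t. t \<in> {1..d} \<Longrightarrow> w t \<in> supported_matrices N ?R"
      and "\<And>x. x \<in> supported_matrices N ?R \<Longrightarrow>
        \<exists>c. \<forall>i<N. \<forall>j<N. x $$ (i, j) = (\<Sum>t\<in>{1..d}. c t * w t $$ (i, j))"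
      and "x \<in> sl N" for w x
    by (rule stabilizer_complement[OF separated_pairs_subset diag stab that])
  have z_mem: "z t \<in> supported_matrices N ?R" if "t \<in> {1..d}" for t
    using matrix_basis_mem[OF separated_pairs_subset z that] .
  have z_span: "filtration v l = span (ordered_monomial z v ` M)"
    unfolding M_def
  proof (rule filtration_eq_span_ordered_monomials)
    show "z ` {1..d} \<subseteq> sl N" using z_mem diag supported_matrices_sl by blast
  qed (rule split[OF z_mem matrix_basis_expand[OF separated_pairs_subset z]])
  have finR: "finite ?R" using separated_pairs_subset by (rule finite_subset) simp
  obtain \<epsilon> where \<epsilon>: "bij_betw \<epsilon> {1..d} ?R"
    using ex_bij_betw_nat_finite_1[OF finR] d D by auto
  have \<epsilon>_mem: "\<epsilon> t \<in> ?R" if "t \<in> {1..d}" for t using \<epsilon> that by (auto simp: bij_betw_def)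
  define w where "w t = (matrix_unit N (\<epsilon> t) :: 'k mat)" for t
  have w_mem: "w t \<in> supported_matrices N ?R" if "t \<in> {1..d}" for t
    using \<epsilon>_mem[OF that] by (auto simp: w_def supported_matrices_def)
  have w_sl: "w ` {1..d} \<subseteq> sl N" using w_mem diag supported_matrices_sl by blast
  have w_span: "filtration v l = span (ordered_monomial w v ` M)"
    unfolding M_def
  proof (rule filtration_eq_span_ordered_monomials[OF w_sl split[OF w_mem]])
    fix x :: "'k mat" assume x: "x \<in> supported_matrices N ?R"
    have "x $$ (i, j) = (\<Sum>t\<in>{1..d}. x $$ \<epsilon> t * w t $$ (i, j))" if ij: "i < N" "j < N" for i j
    proof -
      have "(\<Sum>t\<in>{1..d}. x $$ \<epsilon> t * w t $$ (i, j)) = (\<Sum>p\<in>?R. x $$ p * matrix_unit N p $$ (i, j))"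
        using sum.reindex_bij_betw[OF \<epsilon>, of "\<lambda>p. x $$ p * matrix_unit N p $$ (i, j)"]
        by (simp add: w_def)
      also have "\<dots> = (\<Sum>p\<in>?R. if p = (i, j) then x $$ p else 0)"
        using ij by (intro sum.cong) auto
      also have "\<dots> = x $$ (i, j)"
        using x ij finR by (auto simp: supported_matrices_def)
      finally show ?thesis by simp
    qed
    then show "\<exists>c. \<forall>i<N. \<forall>j<N. x $$ (i, j) = (\<Sum>t\<in>{1..d}. c t * w t $$ (i, j))" 
      by (intro exI[of _ "\<lambda>t. x $$ \<epsilon> t"] allI impI)
  qed
  \<comment> \<open>A monomial in the matrix units, as the word of its index pairs.\<close>
  define word where "word X = map \<epsilon> (sorted_list_of_multiset X)" for X
  have word_set: "set (word X) \<subseteq> ?R" if "X \<in> M" for X using that \<epsilon>_mem by (auto simp: M_def word_def)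
  have word_length: "length (word X) = size X" for X
    unfolding word_def by (metis length_map mset_sorted_list_of_multiset size_mset)
  have word_mset: "inj_on (\<lambda>X. mset (word X)) M"
  proof (rule inj_onI)
    fix X Y assume XY: "X \<in> M" "Y \<in> M" "mset (word X) = mset (word Y)"
    then have "image_mset (inv_into {1..d} \<epsilon>) (image_mset \<epsilon> X) = image_mset (inv_into {1..d} \<epsilon>) (image_mset \<epsilon> Y)"
      by (simp add: word_def)
    moreover have "image_mset (inv_into {1..d} \<epsilon>) (image_mset \<epsilon> X) = X" if "X \<in> M" for X
    proof -
      have "image_mset (\<lambda>t. inv_into {1..d} \<epsilon> (\<epsilon> t)) X = image_mset (\<lambda>t. t) X"
        using that bij_betw_inv_into_left[OF \<epsilon>] by (intro image_mset_cong) (auto simp: M_def)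
      then show ?thesis by (simp add: multiset.map_comp comp_def)
    qed
    ultimately show "X = Y" using XY by metis
  qed
  have word_act: "ordered_monomial w v X = G.e_word (word X) v" if "X \<in> M" for X
  proof -
    have "act_word (map w ts) v = G.e_word (map \<epsilon> ts) v" if "set ts \<subseteq> {1..d}" for ts
      using that w_sl by (induction ts) (auto simp: w_def image_subset_iff gl_act_sl)
    then show ?thesis using that by (simp add: ordered_monomial_def M_def word_def)
  qed
  have low: "\<forall>s\<in>{1..k}. l \<le> ls s"
  proof
    fix s assume "s \<in> {1..k}"
    then have "Min (ls ` {1..k}) \<le> ls s" by (intro Min_le) auto
    then show "l \<le> ls s" using assms(14) by simp
  qed
  have indep: "c X = 0" if "(\<Sum>X\<in>M. scale (c X) (ordered_monomial w v X)) = 0" "X \<in> M" for c X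
  proof -
    let ?inv = "the_inv_into M word"
    have inj: "inj_on word M" using word_mset by (rule inj_on_imageI2[unfolded comp_def])
    have "(\<Sum>ys\<in>word ` M. scale (c (?inv ys)) (G.e_word ys v))
        = (\<Sum>X\<in>M. scale (c X) (ordered_monomial w v X))"
      by (simp add: sum.reindex[OF inj] the_inv_into_f_f[OF inj] word_act)
    then have zero: "(\<Sum>ys\<in>word ` M. scale (c (?inv ys)) (G.e_word ys v)) = 0" using that by simp
    have "c (?inv (word X)) = 0"
    proof (rule G.lowering_words_independent[where X = "word ` M" and Legs = ?Legs and r = ?r and c = "\<lambda>ys. c (?inv ys)"])
      show "inj_on mset (word ` M)" using word_mset by (rule inj_on_imageI[unfolded comp_def])
      show "finite ?Legs" by (simp add: leg_set_def)
      fix m assume "m \<in> ?Legs"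
      then show "?r m \<le> N" using n_bound by (auto simp: leg_set_def)
    next
      fix ys assume "ys \<in> word ` M"
      then obtain X where X: "X \<in> M" "ys = word X" by blast
      have ys: "set ys \<subseteq> ?R" "length ys \<le> l"
        unfolding X(2) using word_set[OF X(1)] word_length[of X] X(1) by (auto simp: M_def)
      show "set ys \<subseteq> {..<N} \<times> {..<N}" using ys separated_pairs_subset by blast
      show "\<exists>bs. set bs \<subseteq> ?Legs \<and> length bs = length ys \<and> admissible ?r (zip bs ys)"
        using ys low by (rule admissible_legs)
    qed (use v(1) finM zero that in auto)
    then show ?thesis using that(2) by (simp add: the_inv_into_f_f[OF inj])
  qed
  have "inj_on (ordered_monomial w v) M" "independent (ordered_monomial w v ` M)"
    by (rule independent_family_image[OF finM]; rule indep; assumption)+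
  then have dim: "dim (filtration v l) = card M"
    unfolding w_span using dim_span_eq_card_independent card_image by metis
  \<comment> \<open>The dimension was found with matrix units; for the basis \<open>z\<close> it is now enough to count.\<close>
  have "card (ordered_monomial z v ` M) \<le> dim (span (ordered_monomial z v ` M))"
    using card_image_le[OF finM] by (simp only: z_span[symmetric] dim)
  then have "independent (ordered_monomial z v ` M)"
    using finM by (intro spanning_set_of_dim_card_independent) auto
  moreover have "dim (filtration v l) = (D + l) choose D"
    using dim card_bounded_multisets[of d l] by (simp add: d M_def)
  ultimately show ?thesis
    unfolding Let_def canonical_filtration_eq monomials_eq_ordered_monomials M_def[symmetric]
    using z_span by simp
qed

end
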